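(* Consider the Gaussian sequence model with parameter space $\Theta(k_n,\tau_n)$, and let $\epsilon_n=k_n/n$, $\mu_n=\tau_n/\sigma_n$, $\nu_n=\sqrt{2\log\epsilon_n^{-1}}$. Suppose $\epsilon_n\to0$ and $\mu_n=\omega(\sqrt{\log\epsilon_n^{-1}})$ as $n\to\infty$. Then $$R(\Theta(k_n,\tau_n),\sigma_n)=n\sigma_n^2\left(2\epsilon_n\log\epsilon_n^{-1}-2\epsilon_n\nu_n\sqrt{2\log\nu_n}\,(1+o(1))\right).$$ In addition, the hard thresholding estimator $\hat\eta_H(y,\lambda_n)$ with $\lambda_n=\sigma_n\sqrt{2\log\epsilon_n^{-1}}$ is asymptotically minimax up to the second order term, i.e. $$\sup_{\theta\in\Theta(k_n,\tau_n)}\mathbb E_\theta\|\hat\eta_H(y,\lambda_n)-\theta\|_2^2=n\sigma_n^2\left(2\epsilon_n\log\epsilon_n^{-1}-2\epsilon_n\nu_n\sqrt{2\log\nu_n}\,(1+o(1))\right).$$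
   Context: Model: for each $n$, one observes $y=(y_1,\dots,y_n)$ with $y_i=\theta_i+\sigma_n z_i$, where $z_i$ are i.i.d. $\mathcal N(0,1)$, $\sigma_n>0$ is known and $\theta\in\mathbb R^n$ is unknown. For integers $1\le k_n\le n$ and $\tau_n>0$, $$\Theta(k_n,\tau_n)=\{\theta\in\mathbb R^n:\ \|\theta\|_0\le k_n,\ \|\theta\|_2^2\le k_n\tau_n^2\},$$ where $\|\theta\|_0$ is the number of nonzero coordinates. The minimax risk is $R(\Theta(k_n,\tau_n),\sigma_n)=\inf_{\hat\theta}\sup_{\theta\in\Theta(k_n,\tau_n)}\mathbb E_\theta\|\hat\theta-\theta\|_2^2$, the infimum being over all estimators (measurable functions of $y$). The hard thresholding estimator has coordinates $[\hat\eta_H(y,\lambda)]_i=y_i\mathbf 1(|y_i|>\lambda)$. Here $o(1)$ denotes a sequence tending to $0$ as $n\to\infty$, and $a_n=\omega(b_n)$ means $b_n/a_n\to 0$. *)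

theory Defs
  imports "HOL-Probability.Probability"
begin

text \<open>Vectors in \<open>R^n\<close>, with \<open>n\<close> varying, are real-valued functions on \<open>{1..n}\<close>,
  extended by \<open>undefined\<close> as in the library's product measures \<open>Pi\<^sub>M\<close>.\<close>

abbreviation vec_space :: "nat \<Rightarrow> (nat \<Rightarrow> real) measure" where
  "vec_space n \<equiv> Pi\<^sub>M {1..n} (\<lambda>_. borel)"

definition gaussian_sequence_model :: "nat \<Rightarrow> real \<Rightarrow> (nat \<Rightarrow> real) \<Rightarrow> (nat \<Rightarrow> real) measure" where
  "gaussian_sequence_model n \<sigma> \<theta> =
     distr (Pi\<^sub>M {1..n} (\<lambda>_. std_normal_distribution)) (vec_space n)
       (\<lambda>z. \<lambda>i\<in>{1..n}. \<theta> i + \<sigma> * z i)"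

definition norm0 :: "nat \<Rightarrow> (nat \<Rightarrow> real) \<Rightarrow> nat" where
  "norm0 n \<theta> = card {i \<in> {1..n}. \<theta> i \<noteq> 0}"

definition sq_norm :: "nat \<Rightarrow> (nat \<Rightarrow> real) \<Rightarrow> real" where
  "sq_norm n \<theta> = (\<Sum>i\<in>{1..n}. (\<theta> i)\<^sup>2)"

definition param_space :: "nat \<Rightarrow> nat \<Rightarrow> real \<Rightarrow> (nat \<Rightarrow> real) set" where
  "param_space n k \<tau> =
     {\<theta> \<in> {1..n} \<rightarrow>\<^sub>E UNIV. norm0 n \<theta> \<le> k \<and> sq_norm n \<theta> \<le> real k * \<tau>\<^sup>2}"

text \<open>The risk is a nonnegative Lebesgue integral, so an estimator of infinite risk really has
  risk \<open>\<infinity>\<close>.\<close>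

definition risk :: "nat \<Rightarrow> real \<Rightarrow> ((nat \<Rightarrow> real) \<Rightarrow> (nat \<Rightarrow> real)) \<Rightarrow> (nat \<Rightarrow> real) \<Rightarrow> ennreal" where
  "risk n \<sigma> est \<theta> =
     (\<integral>\<^sup>+ y. ennreal (sq_norm n (\<lambda>i. est y i - \<theta> i)) \<partial>gaussian_sequence_model n \<sigma> \<theta>)"

definition sup_risk ::
  "nat \<Rightarrow> real \<Rightarrow> (nat \<Rightarrow> real) set \<Rightarrow> ((nat \<Rightarrow> real) \<Rightarrow> (nat \<Rightarrow> real)) \<Rightarrow> ennreal" where
  "sup_risk n \<sigma> \<Theta> est = (SUP \<theta>\<in>\<Theta>. risk n \<sigma> est \<theta>)"

definition minimax_risk :: "nat \<Rightarrow> (nat \<Rightarrow> real) set \<Rightarrow> real \<Rightarrow> ennreal" where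
  "minimax_risk n \<Theta> \<sigma> = (INF est \<in> vec_space n \<rightarrow>\<^sub>M vec_space n. sup_risk n \<sigma> \<Theta> est)"

definition hard_threshold :: "nat \<Rightarrow> real \<Rightarrow> (nat \<Rightarrow> real) \<Rightarrow> (nat \<Rightarrow> real)" where
  "hard_threshold n t y = (\<lambda>i\<in>{1..n}. y i * of_bool (\<bar>y i\<bar> > t))"

end

theory Submission
  imports Defs "HOL-Real_Asymp.Real_Asymp"
begin

text \<open>Write \<open>a = sqrt (2 * ln \<nu>)\<close>, so that \<open>exp (- a\<^sup>2 / 2) = 1 / \<nu>\<close>. Both risks are shown to be
  \<open>k * \<sigma>\<^sup>2 * (\<nu>\<^sup>2 - 2 * \<nu> * a + O(\<nu>))\<close>, which suffices because \<open>a\<close> tends to infinity.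

  For hard thresholding at level \<open>\<nu>\<close>, the null coordinates contribute only \<open>O(k * \<nu>)\<close>. A coordinate
  of mean \<open>m\<close> costs at most \<open>1 + m\<^sup>2 * P(z \<le> \<nu> - \<bar>m\<bar>)\<close>, and the maximum is reached near
  \<open>\<bar>m\<bar> = \<nu> - a\<close>: a smaller mean makes the square smaller, and for a larger one the detection
  probability exceeds \<open>2 * a / \<nu>\<close>.

  For the lower bound, cut the coordinates into \<open>k\<close> blocks of length about \<open>exp (\<nu>\<^sup>2 / 2)\<close> and put one
  spike of height \<open>\<nu> - a\<close> at a uniformly random position of each block. The posterior mass of the
  true position is at most \<open>O(1 / \<nu>)\<close> outside an event of probability \<open>O(1 / \<nu>)\<close>, so the Bayes risk
  per block is at least \<open>(\<nu> - a)\<^sup>2 * (1 - O(1 / \<nu>))\<close>.\<close>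

section \<open>The standard normal distribution\<close>

text \<open>Change of measure: the density of the normal law with mean \<open>m\<close>, divided by
  that of the standard one, is \<open>exp (m * x - m\<^sup>2 / 2)\<close>. The tail bound, the
  truncated moments and the likelihood ratios of the spikes all come from this identity.\<close>

lemma nn_integral_std_normal_shift:
  assumes [measurable]: "g \<in> borel_measurable borel"
  shows "(\<integral>\<^sup>+ x. g (x + m) \<partial>std_normal_distribution) =
    (\<integral>\<^sup>+ x. g x * ennreal (exp (m * x - m\<^sup>2 / 2)) \<partial>std_normal_distribution)"
proof -
  have eq: "std_normal_density (x - m) = std_normal_density x * exp (m * x - m\<^sup>2 / 2)" for x :: real
    by (simp add: std_normal_density_def exp_add[symmetric] power2_eq_square field_simps)
  have "(\<integral>\<^sup>+ x. g (x + m) \<partial>std_normal_distribution) =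
      (\<integral>\<^sup>+ x. ennreal (std_normal_density x) * g (x + m) \<partial>lborel)"
    by (subst nn_integral_density) auto
  also have "\<dots> = (\<integral>\<^sup>+ x. ennreal (std_normal_density (x - m)) * g x \<partial>lborel)"
    by (subst (2) nn_integral_real_affine[where c = 1 and t = m]) (auto simp: add.commute)
  also have "\<dots> = (\<integral>\<^sup>+ x. ennreal (std_normal_density x) * (g x * ennreal (exp (m * x - m\<^sup>2 / 2))) \<partial>lborel)"
    by (intro nn_integral_cong) (simp add: eq ennreal_mult mult_ac)
  also have "\<dots> = (\<integral>\<^sup>+ x. g x * ennreal (exp (m * x - m\<^sup>2 / 2)) \<partial>std_normal_distribution)"
    by (subst nn_integral_density) auto
  finally show ?thesis .
qed

lemma nn_integral_std_normal_reflect: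
  assumes [measurable]: "g \<in> borel_measurable borel"
  shows "(\<integral>\<^sup>+ x. g (- x) \<partial>std_normal_distribution) = (\<integral>\<^sup>+ x. g x \<partial>std_normal_distribution)"
proof -
  have "(\<integral>\<^sup>+ x. g x \<partial>std_normal_distribution) =
      (\<integral>\<^sup>+ x. ennreal (std_normal_density x) * g x \<partial>lborel)"
    by (subst nn_integral_density) auto
  also have "\<dots> = (\<integral>\<^sup>+ x. ennreal (std_normal_density x) * g (- x) \<partial>lborel)"
    by (subst nn_integral_real_affine[where c = "-1" and t = 0]) (auto simp: std_normal_density_def)
  also have "\<dots> = (\<integral>\<^sup>+ x. g (- x) \<partial>std_normal_distribution)"
    by (subst nn_integral_density) auto
  finally show ?thesis by simp
qed

section \<open>Tail bounds and truncated moments of the standard normal law\<close>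

interpretation std_normal: prob_space std_normal_distribution
  using real_dist_normal_dist by (simp add: real_distribution_def)

text \<open>Chernoff bound by tilting: for \<open>y \<ge> x\<close> the exponent
  \<open>x * y - x\<^sup>2\<close> is nonnegative, and the tilted weight
  \<open>exp (x * y - x\<^sup>2 / 2)\<close> integrates to 1.\<close>

lemma std_normal_atLeast_le:
  assumes "x \<ge> 0"
  shows "measure std_normal_distribution {x..} \<le> exp (- x\<^sup>2 / 2)"
proof -
  have "emeasure std_normal_distribution {x..} = (\<integral>\<^sup>+ y. indicator {x..} y \<partial>std_normal_distribution)"
    by simp
  \<comment> \<open>The factor \<open>1\<close> stands for the constant function \<open>g\<close> of
    the shift lemma, which then evaluates the integral.\<close>
  also have "\<dots> \<le> (\<integral>\<^sup>+ y. ennreal (exp (- x\<^sup>2 / 2)) * (1 * ennreal (exp (x * y - x\<^sup>2 / 2))) \<partial>std_normal_distribution)"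
  proof (rule nn_integral_mono)
    fix y :: real
    have "1 \<le> exp (- x\<^sup>2 / 2) * exp (x * y - x\<^sup>2 / 2)" if "y \<ge> x"
      using mult_left_mono[OF that assms] by (simp add: exp_add[symmetric] power2_eq_square)
    then show "indicator {x..} y \<le> ennreal (exp (- x\<^sup>2 / 2)) * (1 * ennreal (exp (x * y - x\<^sup>2 / 2)))"
      by (auto simp: indicator_def ennreal_mult[symmetric] simp flip: ennreal_1 intro!: ennreal_leI)
  qed
  also have "\<dots> = ennreal (exp (- x\<^sup>2 / 2)) * (\<integral>\<^sup>+ y. 1 \<partial>std_normal_distribution)"
    by (subst nn_integral_cmult, simp, subst nn_integral_std_normal_shift[symmetric]) auto
  also have "\<dots> = ennreal (exp (- x\<^sup>2 / 2))"
    using std_normal.emeasure_space_1 by simp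
  finally show ?thesis
    by (simp add: std_normal.emeasure_eq_measure)
qed

lemma std_normal_atMost_uminus:
  "measure std_normal_distribution {..- x} = measure std_normal_distribution {x..}"
proof -
  have "(\<lambda>y. indicator {x..} (- y)) = (indicator {..- x} :: real \<Rightarrow> ennreal)"
    by (auto simp: indicator_def)
  then have "emeasure std_normal_distribution {..- x} = (\<integral>\<^sup>+ y. indicator {x..} (- y) \<partial>std_normal_distribution)"
    by simp
  also have "\<dots> = emeasure std_normal_distribution {x..}"
    by (subst nn_integral_std_normal_reflect) auto
  finally show ?thesis by (simp add: measure_def)
qed

lemma std_normal_atMost_eq: "measure std_normal_distribution {..x} = 1 - measure std_normal_distribution {x<..}"
proof -
  have "{..x} = space std_normal_distribution - {x<..}" by auto
  then show ?thesis by (simp only:) (subst std_normal.prob_compl; simp)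
qed

lemma std_normal_atMost_ge:
  assumes "x \<ge> 0"
  shows "measure std_normal_distribution {..x} \<ge> 1 - exp (- x\<^sup>2 / 2)"
proof -
  have "measure std_normal_distribution {x<..} \<le> measure std_normal_distribution {x..}"
    by (intro std_normal.finite_measure_mono) auto
  with std_normal_atLeast_le[OF assms] show ?thesis by (simp add: std_normal_atMost_eq)
qed

text \<open>The missing mass is at least that of the unit interval from \<open>x\<close> to
  \<open>x + 1\<close>, on which the density is smallest at the right end.\<close>

lemma std_normal_atMost_le:
  assumes "b \<le> x" "x \<ge> 0"
  shows "measure std_normal_distribution {..b} \<le> 1 - std_normal_density (x + 1)"
proof -
  have "ennreal (std_normal_density (x + 1)) = (\<integral>\<^sup>+ y. ennreal (std_normal_density (x + 1)) * indicator {x<..x + 1} y \<partial>lborel)"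
    by (subst nn_integral_cmult_indicator) auto
  also have "\<dots> \<le> (\<integral>\<^sup>+ y. ennreal (std_normal_density y) * indicator {x<..} y \<partial>lborel)"
  proof (rule nn_integral_mono)
    fix y :: real
    have "std_normal_density (x + 1) \<le> std_normal_density y" if "x < y" "y \<le> x + 1"
    proof -
      have "y\<^sup>2 \<le> (x + 1)\<^sup>2" using that assms by (intro power_mono) auto
      then show ?thesis by (simp add: std_normal_density_def divide_right_mono)
    qed
    then show "ennreal (std_normal_density (x + 1)) * indicator {x<..x + 1} y \<le> ennreal (std_normal_density y) * indicator {x<..} y"
      by (auto simp: indicator_def intro!: ennreal_leI)
  qed
  also have "\<dots> = emeasure std_normal_distribution {x<..}"
    by (subst emeasure_density) auto
  finally have "std_normal_density (x + 1) \<le> measure std_normal_distribution {x<..}"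
    by (simp add: std_normal.emeasure_eq_measure)
  also have "\<dots> \<le> measure std_normal_distribution {b<..}"
    using assms by (intro std_normal.finite_measure_mono) auto
  finally show ?thesis by (simp add: std_normal_atMost_eq)
qed

text \<open>For \<open>z \<ge> 2\<close> the integrand \<open>z\<^sup>2\<close> is at most
  \<open>2 * (z\<^sup>2 - 1)\<close>, and \<open>2 * (z\<^sup>2 - 1)\<close> times the density has
  the antiderivative \<open>- 2 * z\<close> times the density. Each one-sided tail is thus bounded
  in closed form; reflection supplies the other side.\<close>

lemma std_normal_truncated_second_moment:
  assumes "x \<ge> 2"
  shows "(\<integral>\<^sup>+ z. ennreal (z\<^sup>2 * of_bool (\<bar>z\<bar> > x)) \<partial>std_normal_distribution) \<le> ennreal (2 * x * exp (- x\<^sup>2 / 2))"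
proof -
  define f :: "real \<Rightarrow> real" where "f = (\<lambda>z. 2 * ((z\<^sup>2 - 1) * std_normal_density z))"
  define F :: "real \<Rightarrow> real" where "F = (\<lambda>z. - 2 * z * std_normal_density z)"
  have lim: "(F \<longlongrightarrow> 0) at_top"
    unfolding F_def std_normal_density_def by real_asymp
  have der: "DERIV F z :> f z" for z
  proof -
    define c where "c = 1 / sqrt (2 * pi)"
    have "DERIV (\<lambda>z. - 2 * z * (c * exp (- z\<^sup>2 / 2))) z :> 2 * ((z\<^sup>2 - 1) * (c * exp (- z\<^sup>2 / 2)))"
      by (auto intro!: derivative_eq_intros simp: algebra_simps power2_eq_square)
    then show ?thesis by (simp add: F_def f_def std_normal_density_def c_def)
  qed
  have sq: "z\<^sup>2 \<ge> 4" if "z \<ge> x" for z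
    using power_mono[of 2 z 2] that assms by simp
  have tail: "(\<integral>\<^sup>+ z. ennreal (f z) * indicator {x..} z \<partial>lborel) = ennreal (0 - F x)"
  proof (rule nn_integral_FTC_atLeast)
    show "f \<in> borel_measurable borel" unfolding f_def by measurable
    show "0 \<le> f z" if "x \<le> z" for z using sq[OF that] by (simp add: f_def)
  qed (use der lim in auto)
  have half: "(\<integral>\<^sup>+ z. ennreal (z\<^sup>2) * indicator {x..} z \<partial>std_normal_distribution) \<le> ennreal (x * exp (- x\<^sup>2 / 2))"
  proof -
    have "(\<integral>\<^sup>+ z. ennreal (z\<^sup>2) * indicator {x..} z \<partial>std_normal_distribution) =
        (\<integral>\<^sup>+ z. ennreal (std_normal_density z) * (ennreal (z\<^sup>2) * indicator {x..} z) \<partial>lborel)"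
      by (subst nn_integral_density) auto
    also have "\<dots> \<le> (\<integral>\<^sup>+ z. ennreal (f z) * indicator {x..} z \<partial>lborel)"
    proof (rule nn_integral_mono)
      fix z :: real
      have "std_normal_density z * z\<^sup>2 \<le> f z" if "z \<ge> x"
      proof -
        have "z\<^sup>2 \<le> 2 * (z\<^sup>2 - 1)" using sq[OF that] by simp
        from mult_left_mono[OF this, of "std_normal_density z"] show ?thesis
          by (simp add: f_def algebra_simps)
      qed
      then show "ennreal (std_normal_density z) * (ennreal (z\<^sup>2) * indicator {x..} z) \<le> ennreal (f z) * indicator {x..} z"
        by (auto simp: indicator_def ennreal_mult[symmetric] intro!: ennreal_leI)
    qed
    also have "\<dots> = ennreal (2 / sqrt (2 * pi) * (x * exp (- x\<^sup>2 / 2)))"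
      unfolding tail by (simp add: F_def std_normal_density_def mult_ac)
    also have "\<dots> \<le> ennreal (1 * (x * exp (- x\<^sup>2 / 2)))"
    proof (intro ennreal_leI mult_right_mono)
      have "2 = sqrt 4" by simp
      also have "\<dots> \<le> sqrt (2 * pi)" using pi_gt3 by (intro real_sqrt_le_mono) simp
      finally show "2 / sqrt (2 * pi) \<le> 1" using pi_gt_zero by (simp add: field_simps)
    qed (use assms in auto)
    finally show ?thesis by simp
  qed
  have "(\<integral>\<^sup>+ z. ennreal (z\<^sup>2 * of_bool (\<bar>z\<bar> > x)) \<partial>std_normal_distribution) \<le>
      (\<integral>\<^sup>+ z. ennreal (z\<^sup>2) * indicator {x..} z + ennreal ((- z)\<^sup>2) * indicator {x..} (- z) \<partial>std_normal_distribution)"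
    using assms by (intro nn_integral_mono) (auto simp: indicator_def)
  also have "\<dots> = (\<integral>\<^sup>+ z. ennreal (z\<^sup>2) * indicator {x..} z \<partial>std_normal_distribution) +
      (\<integral>\<^sup>+ z. ennreal ((- z)\<^sup>2) * indicator {x..} (- z) \<partial>std_normal_distribution)"
    by (rule nn_integral_add) auto
  also have "(\<integral>\<^sup>+ z. ennreal ((- z)\<^sup>2) * indicator {x..} (- z) \<partial>std_normal_distribution) =
     (\<integral>\<^sup>+ z. ennreal (z\<^sup>2) * indicator {x..} z \<partial>std_normal_distribution)"
    by (rule nn_integral_std_normal_reflect) auto
  also have "(\<integral>\<^sup>+ z. ennreal (z\<^sup>2) * indicator {x..} z \<partial>std_normal_distribution) + \<dots> \<le>
     ennreal (x * exp (- x\<^sup>2 / 2)) + ennreal (x * exp (- x\<^sup>2 / 2))"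
    by (intro add_mono half)
  also have "\<dots> = ennreal (2 * x * exp (- x\<^sup>2 / 2))"
    using assms by (simp flip: ennreal_plus)
  finally show ?thesis .
qed

section \<open>An exponential lower-tail bound for sums of independent nonnegative variables\<close>

lemma exp_minus_le_quadratic:
  assumes "x \<ge> (0::real)"
  shows "exp (- x) \<le> 1 - x + x\<^sup>2 / 2"
proof -
  define f :: "real \<Rightarrow> real" where "f = (\<lambda>x. 1 - x + x\<^sup>2 / 2 - exp (- x))"
  have "f 0 \<le> f x"
  proof (rule DERIV_nonneg_imp_nondecreasing[OF assms])
    fix y :: real
    have "DERIV f y :> - 1 + y + exp (- y)"
      unfolding f_def by (auto intro!: derivative_eq_intros)
    moreover have "0 \<le> - 1 + y + exp (- y)" using exp_ge_add_one_self[of "- y"] by simp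
    ultimately show "\<exists>d. DERIV f y :> d \<and> 0 \<le> d" by blast
  qed
  then show ?thesis by (simp add: f_def)
qed

text \<open>For nonnegative variables \<open>exp (- t * X)\<close> is bounded by its second order
  Taylor polynomial, so two moments control the Laplace transform. The bound \<open>K\<close>
  provides integrability and does not enter the result; this matters because the truncated
  exponentials have a very large maximum.\<close>

lemma (in prob_space) prod_lower_tail:
  fixes X :: "'a \<Rightarrow> real" and I J :: "'i set"
  assumes X[measurable]: "X \<in> borel_measurable M" and bdd: "\<And>x. 0 \<le> X x" "\<And>x. X x \<le> K"
    and I: "finite I" "J \<subseteq> I"
    and m: "0 < m1" "m1 \<le> expectation X" "0 < m2" "expectation (\<lambda>x. (X x)\<^sup>2) \<le> m2"
  shows "measure (Pi\<^sub>M I (\<lambda>_. M)) {z \<in> space (Pi\<^sub>M I (\<lambda>_. M)). (\<Sum>j\<in>J. X (z j)) < real (card J) * m1 / 2}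
     \<le> exp (- (real (card J) * m1\<^sup>2 / (8 * m2)))"
proof -
  let ?P = "Pi\<^sub>M I (\<lambda>_. M)"
  interpret P: product_prob_space "\<lambda>_. M" I by unfold_locales
  have fJ: "finite J" using I finite_subset by auto
  \<comment> \<open>This \<open>t\<close> minimises the exponent
    \<open>N * (- t * m1 / 2 + t\<^sup>2 * m2 / 2)\<close> that Markov's inequality
    produces.\<close>
  define t where "t = m1 / (2 * m2)"
  have t: "t > 0" using m by (simp add: t_def)
  define N where "N = real (card J)"
  have intX: "integrable M X"
    using bdd by (intro integrable_const_bound[where B = K]) auto
  have intX2: "integrable M (\<lambda>x. (X x)\<^sup>2)"
    using bdd by (intro integrable_const_bound[where B = "K\<^sup>2"]) (auto intro!: power_mono)
  have intE: "integrable M (\<lambda>x. exp (- (t * X x)))"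
    using bdd t by (intro integrable_const_bound[where B = 1]) auto
  have mgf: "(\<integral>\<^sup>+ x. ennreal (exp (- (t * X x))) \<partial>M) \<le> ennreal (exp (- t * m1 + t\<^sup>2 * m2 / 2))"
  proof -
    have "expectation (\<lambda>x. exp (- (t * X x))) \<le> expectation (\<lambda>x. 1 - t * X x + t\<^sup>2 * (X x)\<^sup>2 / 2)"
      using exp_minus_le_quadratic[of "t * X _"] bdd t intX intX2 intE
      by (intro integral_mono) (auto simp: power_mult_distrib)
    also have "\<dots> = 1 - t * expectation X + t\<^sup>2 * expectation (\<lambda>x. (X x)\<^sup>2) / 2"
      using intX intX2 by (simp add: prob_space)
    also have "\<dots> \<le> 1 + (- t * m1 + t\<^sup>2 * m2 / 2)"
    proof -
      have "t * m1 \<le> t * expectation X" "t\<^sup>2 * expectation (\<lambda>x. (X x)\<^sup>2) \<le> t\<^sup>2 * m2"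
        using m t by (auto intro!: mult_left_mono)
      then show ?thesis by linarith
    qed
    also have "\<dots> \<le> exp (- t * m1 + t\<^sup>2 * m2 / 2)" by (rule exp_ge_add_one_self)
    finally show ?thesis
      using intE by (subst nn_integral_eq_integral) (auto intro!: ennreal_leI)
  qed
  have [measurable]: "(\<lambda>z. X (z j)) \<in> borel_measurable ?P" if "j \<in> J" for j
    using that I by (intro measurable_compose[OF _ X] measurable_component_singleton) auto
  have "emeasure ?P {z \<in> space ?P. (\<Sum>j\<in>J. X (z j)) < N * m1 / 2} =
     (\<integral>\<^sup>+ z. indicator {z \<in> space ?P. (\<Sum>j\<in>J. X (z j)) < N * m1 / 2} z \<partial>?P)"
    by (subst nn_integral_indicator) auto
  \<comment> \<open>Coordinates outside \<open>J\<close> receive the factor 1, so that the product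
    runs over the whole index set and factorises under the product measure.\<close>
  also have "\<dots> \<le> (\<integral>\<^sup>+ z. ennreal (exp (t * N * m1 / 2)) *
     (\<Prod>i\<in>I. (if i \<in> J then ennreal (exp (- (t * X (z i)))) else 1)) \<partial>?P)"
  proof (rule nn_integral_mono)
    fix z
    have eq: "(\<Prod>i\<in>I. (if i \<in> J then ennreal (exp (- (t * X (z i)))) else 1)) =
        ennreal (exp (- t * (\<Sum>j\<in>J. X (z j))))"
    proof -
      have "(\<Prod>i\<in>I. (if i \<in> J then ennreal (exp (- (t * X (z i)))) else 1)) =
          (\<Prod>i\<in>J. ennreal (exp (- (t * X (z i)))))"
        using I by (subst prod.inter_restrict[symmetric]) (auto simp: Int_absorb1)
      also have "\<dots> = ennreal (\<Prod>i\<in>J. exp (- (t * X (z i))))"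
        by (rule prod_ennreal) auto
      also have "(\<Prod>i\<in>J. exp (- (t * X (z i)))) = exp (- t * (\<Sum>j\<in>J. X (z j)))"
        using fJ by (simp add: exp_sum[symmetric] sum_negf sum_distrib_left)
      finally show ?thesis .
    qed
    have "1 \<le> exp (t * N * m1 / 2) * exp (- t * (\<Sum>j\<in>J. X (z j)))" if "(\<Sum>j\<in>J. X (z j)) < N * m1 / 2"
      using mult_left_mono[OF less_imp_le[OF that], of t] t by (simp add: exp_add[symmetric])
    then show "indicator {z \<in> space ?P. (\<Sum>j\<in>J. X (z j)) < N * m1 / 2} z \<le> ennreal (exp (t * N * m1 / 2)) *
      (\<Prod>i\<in>I. (if i \<in> J then ennreal (exp (- (t * X (z i)))) else 1))"
      unfolding eq
      by (auto simp: indicator_def ennreal_mult[symmetric] simp flip: ennreal_1 intro!: ennreal_leI)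
  qed
  also have "\<dots> = ennreal (exp (t * N * m1 / 2)) *
      (\<integral>\<^sup>+ z. (\<Prod>i\<in>I. (if i \<in> J then ennreal (exp (- (t * X (z i)))) else 1)) \<partial>?P)"
  proof (rule nn_integral_cmult)
    have "(\<lambda>z. (if i \<in> J then ennreal (exp (- (t * X (z i)))) else 1)) \<in> borel_measurable ?P" for i
      by (cases "i \<in> J") auto
    then show "(\<lambda>z. \<Prod>i\<in>I. (if i \<in> J then ennreal (exp (- (t * X (z i)))) else 1)) \<in> borel_measurable ?P"
      by (intro borel_measurable_prod_ennreal)
  qed
  also have "(\<integral>\<^sup>+ z. (\<Prod>i\<in>I. (if i \<in> J then ennreal (exp (- (t * X (z i)))) else 1)) \<partial>?P) =
     (\<Prod>i\<in>I. (\<integral>\<^sup>+ x. (if i \<in> J then ennreal (exp (- (t * X x))) else 1) \<partial>M))"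
    by (rule P.product_nn_integral_prod[OF I(1)]) (auto)
  also have "\<dots> = (\<Prod>i\<in>I. (if i \<in> J then (\<integral>\<^sup>+ x. ennreal (exp (- (t * X x))) \<partial>M) else 1))"
    by (intro prod.cong) (auto simp: emeasure_space_1)
  also have "\<dots> = (\<Prod>i\<in>J. (\<integral>\<^sup>+ x. ennreal (exp (- (t * X x))) \<partial>M))"
    using I by (subst prod.inter_restrict[symmetric]) (auto simp: Int_absorb1)
  also have "\<dots> \<le> (\<Prod>i\<in>J. ennreal (exp (- t * m1 + t\<^sup>2 * m2 / 2)))"
    by (intro prod_mono_ennreal mgf)
  also have "\<dots> = ennreal (exp (N * (- t * m1 + t\<^sup>2 * m2 / 2)))"
    by (simp add: N_def ennreal_power exp_of_nat_mult)
  also have "ennreal (exp (t * N * m1 / 2)) * \<dots> = ennreal (exp (t * N * m1 / 2 + N * (- t * m1 + t\<^sup>2 * m2 / 2)))"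
    by (simp add: ennreal_mult[symmetric] exp_add)
  also have "t * N * m1 / 2 + N * (- t * m1 + t\<^sup>2 * m2 / 2) = - (N * m1\<^sup>2 / (8 * m2))"
    using m by (simp add: t_def power2_eq_square field_simps)
  finally show ?thesis
    unfolding N_def[symmetric] by (simp add: P.P.emeasure_eq_measure mult_left_mono)
qed

section \<open>Finite products of standard normal laws\<close>

lemma sets_PiM_std_normal [measurable_cong]:
  "sets (Pi\<^sub>M I (\<lambda>_. std_normal_distribution)) = sets (Pi\<^sub>M I (\<lambda>_. borel))"
  by (intro sets_PiM_cong) auto

lemma product_prob_space_std_normal: "product_prob_space (\<lambda>_. std_normal_distribution)"
  by unfold_locales

lemma prob_space_PiM_std_normal: "prob_space (Pi\<^sub>M I (\<lambda>_. std_normal_distribution))"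
  by (rule prob_space_PiM) unfold_locales

lemma nn_integral_PiM_std_normal_component:
  assumes "i \<in> I" and [measurable]: "g \<in> borel_measurable borel"
  shows "(\<integral>\<^sup>+ z. g (z i) \<partial>Pi\<^sub>M I (\<lambda>_. std_normal_distribution)) = (\<integral>\<^sup>+ x. g x \<partial>std_normal_distribution)"
proof -
  have "(\<integral>\<^sup>+ x. g x \<partial>std_normal_distribution) =
      (\<integral>\<^sup>+ x. g x \<partial>distr (Pi\<^sub>M I (\<lambda>_. std_normal_distribution)) std_normal_distribution (\<lambda>z. z i))"
    using assms by (subst distr_PiM_component) (auto intro: std_normal.prob_space_axioms)
  also have "\<dots> = (\<integral>\<^sup>+ z. g (z i) \<partial>Pi\<^sub>M I (\<lambda>_. std_normal_distribution))"
    using assms by (subst nn_integral_distr) auto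
  finally show ?thesis by simp
qed

text \<open>Fubini isolates coordinate \<open>j\<close>, to which the one-dimensional change of
  measure applies.\<close>

lemma nn_integral_PiM_std_normal_shift:
  assumes I: "finite I" "j \<in> I" and g: "g \<in> borel_measurable (Pi\<^sub>M I (\<lambda>_. borel))"
  shows "(\<integral>\<^sup>+ z. g (z(j := z j + m)) \<partial>Pi\<^sub>M I (\<lambda>_. std_normal_distribution)) =
    (\<integral>\<^sup>+ z. g z * ennreal (exp (m * z j - m\<^sup>2 / 2)) \<partial>Pi\<^sub>M I (\<lambda>_. std_normal_distribution))"
proof -
  interpret product_prob_space "\<lambda>_. std_normal_distribution" I
    by (rule product_prob_space_std_normal)
  define I' where "I' = I - {j}"
  have I': "finite I'" "j \<notin> I'" "I = insert j I'" using I by (auto simp: I'_def)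
  note g' [measurable] = g[unfolded I'(3)]
  have shift: "(\<lambda>z. z(j := z j + m)) \<in> Pi\<^sub>M (insert j I') (\<lambda>_. borel) \<rightarrow>\<^sub>M Pi\<^sub>M (insert j I') (\<lambda>_. borel)"
    by (rule measurable_fun_upd[where J = "insert j I'"]) auto
  have upd: "(\<lambda>y. x(j := y)) \<in> borel \<rightarrow>\<^sub>M Pi\<^sub>M (insert j I') (\<lambda>_. borel)"
    if "x \<in> space (Pi\<^sub>M I' (\<lambda>_. std_normal_distribution))" for x :: "'a \<Rightarrow> real"
    using that by (intro measurable_fun_upd[where J = I']) (auto simp: space_PiM)
  have "(\<integral>\<^sup>+ z. g (z(j := z j + m)) \<partial>Pi\<^sub>M (insert j I') (\<lambda>_. std_normal_distribution)) =
     (\<integral>\<^sup>+ x. (\<integral>\<^sup>+ y. g (x(j := y + m)) \<partial>std_normal_distribution) \<partial>Pi\<^sub>M I' (\<lambda>_. std_normal_distribution))"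
    by (subst product_nn_integral_insert[OF I'(1,2)])
       (use measurable_compose[OF shift g'] in \<open>auto simp: measurable_def sets_PiM_std_normal space_PiM\<close>)
  also have "\<dots> = (\<integral>\<^sup>+ x. (\<integral>\<^sup>+ y. g (x(j := y)) * ennreal (exp (m * y - m\<^sup>2 / 2)) \<partial>std_normal_distribution)
       \<partial>Pi\<^sub>M I' (\<lambda>_. std_normal_distribution))"
    by (intro nn_integral_cong nn_integral_std_normal_shift measurable_compose[OF upd g'])
  also have "\<dots> = (\<integral>\<^sup>+ z. g z * ennreal (exp (m * z j - m\<^sup>2 / 2)) \<partial>Pi\<^sub>M (insert j I') (\<lambda>_. std_normal_distribution))"
    by (subst product_nn_integral_insert[OF I'(1,2)]) auto
  finally show ?thesis by (simp add: I'(3)[symmetric])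
qed

section \<open>Upper bound for hard thresholding\<close>

lemma hard_threshold_measurable: "hard_threshold n t \<in> vec_space n \<rightarrow>\<^sub>M vec_space n"
  unfolding hard_threshold_def by measurable

lemma gaussian_sequence_model_measurable:
  "(\<lambda>z. \<lambda>i\<in>{1..n}. \<theta> i + \<sigma> * z i) \<in> Pi\<^sub>M {1..n} (\<lambda>_. std_normal_distribution) \<rightarrow>\<^sub>M vec_space n"
  by measurable

definition scalar_risk :: "real \<Rightarrow> real \<Rightarrow> ennreal" where
  "scalar_risk t m = (\<integral>\<^sup>+ z. ennreal (((m + z) * of_bool (\<bar>m + z\<bar> > t) - m)\<^sup>2) \<partial>std_normal_distribution)"

text \<open>Thresholding acts coordinatewise and the loss is a sum. Measuring mean and threshold in
  units of \<open>\<sigma>\<close> reduces each coordinate to unit noise.\<close>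

lemma risk_hard_threshold:
  assumes "\<sigma> > 0"
  shows "risk n \<sigma> (hard_threshold n (\<sigma> * t)) \<theta> = (\<Sum>i\<in>{1..n}. ennreal (\<sigma>\<^sup>2) * scalar_risk t (\<theta> i / \<sigma>))"
proof -
  have eq: "((\<theta> i + \<sigma> * z) * of_bool (\<bar>\<theta> i + \<sigma> * z\<bar> > \<sigma> * t) - \<theta> i)\<^sup>2 =
      \<sigma>\<^sup>2 * ((\<theta> i / \<sigma> + z) * of_bool (\<bar>\<theta> i / \<sigma> + z\<bar> > t) - \<theta> i / \<sigma>)\<^sup>2" for i and z :: real
  proof -
    have 1: "\<theta> i + \<sigma> * z = \<sigma> * (\<theta> i / \<sigma> + z)" using assms by (simp add: field_simps)
    have "\<bar>\<theta> i + \<sigma> * z\<bar> = \<sigma> * \<bar>\<theta> i / \<sigma> + z\<bar>" unfolding 1 using assms by (simp add: abs_mult)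
    then have 2: "\<bar>\<theta> i + \<sigma> * z\<bar> > \<sigma> * t \<longleftrightarrow> \<bar>\<theta> i / \<sigma> + z\<bar> > t" using assms by simp
    have 3: "(\<theta> i + \<sigma> * z) * b - \<theta> i = \<sigma> * ((\<theta> i / \<sigma> + z) * b - \<theta> i / \<sigma>)" for b
      using assms by (simp add: field_simps)
    show ?thesis unfolding 2 unfolding 3 power_mult_distrib ..
  qed
  have "risk n \<sigma> (hard_threshold n (\<sigma> * t)) \<theta> =
     (\<integral>\<^sup>+ z. ennreal (sq_norm n (\<lambda>i. hard_threshold n (\<sigma> * t) (\<lambda>i\<in>{1..n}. \<theta> i + \<sigma> * z i) i - \<theta> i))
        \<partial>Pi\<^sub>M {1..n} (\<lambda>_. std_normal_distribution))"
    unfolding risk_def gaussian_sequence_model_def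
    by (subst nn_integral_distr[OF gaussian_sequence_model_measurable])
       (auto simp: sq_norm_def hard_threshold_def)
  also have "\<dots> = (\<integral>\<^sup>+ z. (\<Sum>i\<in>{1..n}. ennreal (\<sigma>\<^sup>2 * ((\<theta> i / \<sigma> + z i) * of_bool (\<bar>\<theta> i / \<sigma> + z i\<bar> > t) - \<theta> i / \<sigma>)\<^sup>2))
        \<partial>Pi\<^sub>M {1..n} (\<lambda>_. std_normal_distribution))"
    by (intro nn_integral_cong) (auto simp: sq_norm_def hard_threshold_def eq simp flip: sum_ennreal)
  also have "\<dots> = (\<Sum>i\<in>{1..n}. (\<integral>\<^sup>+ z. ennreal (\<sigma>\<^sup>2 * ((\<theta> i / \<sigma> + z i) * of_bool (\<bar>\<theta> i / \<sigma> + z i\<bar> > t) - \<theta> i / \<sigma>)\<^sup>2)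
        \<partial>Pi\<^sub>M {1..n} (\<lambda>_. std_normal_distribution)))"
    by (rule nn_integral_sum) measurable
  also have "\<dots> = (\<Sum>i\<in>{1..n}. ennreal (\<sigma>\<^sup>2) * scalar_risk t (\<theta> i / \<sigma>))"
    by (intro sum.cong refl, subst nn_integral_PiM_std_normal_component)
       (auto simp: scalar_risk_def ennreal_mult nn_integral_cmult)
  finally show ?thesis .
qed

lemma scalar_risk_0_le:
  assumes "t \<ge> 2"
  shows "scalar_risk t 0 \<le> ennreal (2 * t * exp (- t\<^sup>2 / 2))"
proof -
  have "scalar_risk t 0 = (\<integral>\<^sup>+ z. ennreal (z\<^sup>2 * of_bool (\<bar>z\<bar> > t)) \<partial>std_normal_distribution)"
    unfolding scalar_risk_def by (intro nn_integral_cong) (auto simp: of_bool_def)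
  then show ?thesis using std_normal_truncated_second_moment[OF assms] by simp
qed

lemma nn_integral_std_normal_square: "(\<integral>\<^sup>+ z. ennreal (z\<^sup>2) \<partial>std_normal_distribution) = 1"
proof -
  have "has_bochner_integral lborel (\<lambda>x. std_normal_density x * x\<^sup>2) 1"
    using std_normal_moment_even[of 1] by simp
  then show ?thesis
    by (subst nn_integral_density) (auto simp: ennreal_mult[symmetric] has_bochner_integral_iff nn_integral_eq_integral)
qed

text \<open>A kept observation has error \<open>z\<close>, a discarded one has error
  \<open>m\<close>. For \<open>m \<ge> 0\<close> discarding forces \<open>z \<le> t - m\<close>; for
  negative \<open>m\<close> the mirrored event has the same probability by symmetry.\<close>

lemma scalar_risk_le: "scalar_risk t m \<le> ennreal (1 + m\<^sup>2 * measure std_normal_distribution {..t - \<bar>m\<bar>})"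
proof -
  define A where "A = {z. \<bar>m + z\<bar> \<le> t}"
  have [measurable]: "A \<in> sets borel" unfolding A_def by measurable
  have "measure std_normal_distribution A \<le> measure std_normal_distribution {..t - \<bar>m\<bar>}"
  proof (cases "m \<ge> 0")
    case True
    then show ?thesis by (intro std_normal.finite_measure_mono) (auto simp: A_def)
  next
    case False
    then have "measure std_normal_distribution A \<le> measure std_normal_distribution {- (t - \<bar>m\<bar>)..}"
      by (intro std_normal.finite_measure_mono) (auto simp: A_def)
    then show ?thesis using std_normal_atMost_uminus[of "- (t - \<bar>m\<bar>)"] by simp
  qed
  note A = this
  have "scalar_risk t m \<le> (\<integral>\<^sup>+ z. ennreal (z\<^sup>2) + ennreal (m\<^sup>2) * indicator A z \<partial>std_normal_distribution)"
    unfolding scalar_risk_def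
  proof (rule nn_integral_mono)
    fix z
    show "ennreal (((m + z) * of_bool (t < \<bar>m + z\<bar>) - m)\<^sup>2) \<le> ennreal (z\<^sup>2) + ennreal (m\<^sup>2) * indicator A z"
      by (cases "\<bar>m + z\<bar> \<le> t") (auto simp: A_def indicator_def simp flip: ennreal_plus intro!: ennreal_leI)
  qed
  also have "\<dots> = 1 + ennreal (m\<^sup>2) * emeasure std_normal_distribution A"
    by (subst nn_integral_add) (auto simp: nn_integral_std_normal_square nn_integral_cmult_indicator)
  also have "\<dots> = ennreal (1 + m\<^sup>2 * measure std_normal_distribution A)"
    by (simp add: std_normal.emeasure_eq_measure ennreal_mult ennreal_plus)
  also have "\<dots> \<le> ennreal (1 + m\<^sup>2 * measure std_normal_distribution {..t - \<bar>m\<bar>})"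
    by (intro ennreal_leI add_left_mono mult_left_mono A) auto
  finally show ?thesis .
qed

lemma std_normal_density_1_ge: "std_normal_density 1 \<ge> 1 / 5"
proof -
  have "(exp (1 / 2 :: real))\<^sup>2 = exp 1"
    by (simp add: power2_eq_square exp_add[symmetric])
  then have "(sqrt (2 * pi) * exp (1 / 2))\<^sup>2 = 2 * pi * exp 1"
    by (simp add: power_mult_distrib)
  also have "\<dots> \<le> 2 * 4 * 3"
    using pi_less_4 exp_le by (intro mult_mono) auto
  also have "\<dots> \<le> 5\<^sup>2" by simp
  finally have "sqrt (2 * pi) * exp (1 / 2) \<le> 5" by (rule power2_le_imp_le) simp
  then show ?thesis by (simp add: std_normal_density_def exp_minus field_simps)
qed

lemma worst_mean_bound:
  "\<forall>\<^sub>F t in at_top. \<forall>m. m\<^sup>2 * measure std_normal_distribution {..t - \<bar>m\<bar>} \<le>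
     t\<^sup>2 - 2 * t * sqrt (2 * ln t) + 5 * t"
proof -
  have "\<forall>\<^sub>F t in at_top. (2::real) \<le> sqrt (2 * ln t)" by real_asymp
  moreover have "\<forall>\<^sub>F t::real in at_top. (t - sqrt (2 * ln t) + 2)\<^sup>2 \<le> t\<^sup>2 - 2 * t * sqrt (2 * ln t) + 5 * t" by real_asymp
  \<comment> \<open>With \<open>s = sqrt (2 * ln t)\<close> one has
    \<open>exp (- s\<^sup>2 / 2) = 1 / t\<close>. Evaluating the density at \<open>s - 1\<close>
    instead of \<open>s\<close> gains a factor \<open>exp (s - 1 / 2)\<close>, which outgrows the
    needed \<open>2 * s\<close>.\<close>
  moreover have "\<forall>\<^sub>F t in at_top. 2 * sqrt (2 * ln t) / t \<le> std_normal_density (sqrt (2 * ln t) - 1)"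
  proof -
    have "\<forall>\<^sub>F s in at_top. 2 * s * exp (- s\<^sup>2 / 2) \<le> std_normal_density (s - 1)"
      unfolding std_normal_density_def by real_asymp
    moreover have "filterlim (\<lambda>t::real. sqrt (2 * ln t)) at_top at_top" by real_asymp
    ultimately have "\<forall>\<^sub>F t in at_top. 2 * sqrt (2 * ln t) * exp (- (sqrt (2 * ln t))\<^sup>2 / 2) \<le>
        std_normal_density (sqrt (2 * ln t) - 1)"
      by (rule eventually_compose_filterlim)
    then show ?thesis using eventually_ge_at_top[of 1]
      by eventually_elim (simp add: exp_minus field_simps)
  qed
  \<comment> \<open>The constant is \<open>2 * 101\<^sup>2\<close>, the bound reached in the last
    case below for means far above the threshold.\<close>
  moreover have "\<forall>\<^sub>F t::real in at_top. 20402 \<le> t\<^sup>2 - 2 * t * sqrt (2 * ln t) + 5 * t" by real_asymp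
  moreover have "\<forall>\<^sub>F t::real in at_top. 9 / 10 * t\<^sup>2 \<le> t\<^sup>2 - 2 * t * sqrt (2 * ln t) + 5 * t" by real_asymp
  moreover have "\<forall>\<^sub>F t::real in at_top. t > 0" by real_asymp
  ultimately show ?thesis
  proof (eventually_elim, safe)
    fix t m :: real
    define a where "a = sqrt (2 * ln t)"
    define b where "b = t - \<bar>m\<bar>"
    let ?p = "measure std_normal_distribution {..t - \<bar>m\<bar>}"
    assume *: "2 \<le> sqrt (2 * ln t)" "(t - sqrt (2 * ln t) + 2)\<^sup>2 \<le> t\<^sup>2 - 2 * t * sqrt (2 * ln t) + 5 * t"
       "2 * sqrt (2 * ln t) / t \<le> std_normal_density (sqrt (2 * ln t) - 1)"
       "20402 \<le> t\<^sup>2 - 2 * t * sqrt (2 * ln t) + 5 * t"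
       "9 / 10 * t\<^sup>2 \<le> t\<^sup>2 - 2 * t * sqrt (2 * ln t) + 5 * t" "t > 0"
    note * = *[folded a_def]
    have m: "m\<^sup>2 = (t - b)\<^sup>2" "t - b \<ge> 0" by (auto simp: b_def)
    have p: "0 \<le> ?p" "?p \<le> 1" by auto
    \<comment> \<open>Here \<open>b\<close> is how far the mean lies below the threshold. First
      case: the square alone is small. Second: \<open>m\<^sup>2 \<le> t\<^sup>2\<close>, and
      detection has probability at least \<open>2 * a / t\<close>; the offset 2 leaves room for the
      unit interval of \<open>std_normal_atMost_le\<close> and for evaluating the density at
      \<open>a - 1\<close>. Third: the mean exceeds the threshold by at most one percent, and
      detection has probability at least 1/5. Fourth: the Gaussian tail beats the square.\<close>
    consider "b \<ge> a - 2" | "0 \<le> b" "b \<le> a - 2" | "- t / 100 \<le> b" "b \<le> 0" | "b < - t / 100"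
      by linarith
    then have "m\<^sup>2 * ?p \<le> t\<^sup>2 - 2 * t * a + 5 * t"
    proof cases
      case 1
      have "m\<^sup>2 * ?p \<le> m\<^sup>2 * 1" by (intro mult_left_mono p) auto
      also have "\<dots> \<le> (t - a + 2)\<^sup>2" unfolding m(1) mult_1_right using 1 m(2) by (intro power_mono) auto
      finally show ?thesis using * by linarith
    next
      case 2
      have "?p \<le> 1 - std_normal_density (a - 2 + 1)"
        by (rule std_normal_atMost_le) (use 2 in \<open>auto simp: b_def\<close>)
      also have "\<dots> \<le> 1 - 2 * a / t" using *(3) by simp
      finally have "m\<^sup>2 * ?p \<le> t\<^sup>2 * (1 - 2 * a / t)"
        unfolding m(1) using 2 m(2) p by (intro mult_mono power_mono) auto
      also have "\<dots> = t\<^sup>2 - 2 * t * a" using \<open>t > 0\<close> by (simp add: field_simps power2_eq_square)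
      finally show ?thesis using \<open>t > 0\<close> by linarith
    next
      case 3
      have "?p \<le> 1 - std_normal_density (0 + 1)"
        by (rule std_normal_atMost_le) (use 3 in \<open>auto simp: b_def\<close>)
      also have "\<dots> \<le> 4 / 5" using std_normal_density_1_ge by simp
      finally have "m\<^sup>2 * ?p \<le> (101 / 100 * t)\<^sup>2 * (4 / 5)"
        unfolding m(1) using 3 m(2) p by (intro mult_mono power_mono) auto
      also have "\<dots> \<le> 9 / 10 * t\<^sup>2" by (simp add: power_mult_distrib power2_eq_square)
      finally show ?thesis using *(5) by linarith
    next
      case 4
      define x where "x = - b"
      have x: "x > 0" "t - b \<le> 101 * x" using 4 \<open>t > 0\<close> by (auto simp: x_def)
      have "?p = measure std_normal_distribution {..- x}" by (simp add: x_def b_def)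
      also have "\<dots> \<le> exp (- x\<^sup>2 / 2)"
        using std_normal_atLeast_le[of x] x by (simp add: std_normal_atMost_uminus)
      finally have "m\<^sup>2 * ?p \<le> (101 * x)\<^sup>2 * exp (- x\<^sup>2 / 2)"
        unfolding m(1) using x m(2) p by (intro mult_mono power_mono) auto
      also have "\<dots> = 20402 * (x\<^sup>2 / 2 * exp (- (x\<^sup>2 / 2)))" by (simp add: power_mult_distrib)
      also have "\<dots> \<le> 20402 * 1"
      proof (intro mult_left_mono)
        have "x\<^sup>2 / 2 \<le> exp (x\<^sup>2 / 2)" using exp_ge_add_one_self[of "x\<^sup>2 / 2"] by linarith
        then show "x\<^sup>2 / 2 * exp (- (x\<^sup>2 / 2)) \<le> 1" by (simp add: exp_minus field_simps)
      qed auto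
      finally show ?thesis using *(4) by linarith
    qed
    then show "m\<^sup>2 * ?p \<le> t\<^sup>2 - 2 * t * sqrt (2 * ln t) + 5 * t" by (simp add: a_def)
  qed
qed

text \<open>The null risk \<open>r0\<close> is charged to all \<open>n\<close> coordinates and
  \<open>r1\<close> is added on the support. This overcharges the support, but spares the count of
  the null coordinates.\<close>

lemma risk_hard_threshold_le:
  assumes \<sigma>: "\<sigma> > 0" and \<theta>: "norm0 n \<theta> \<le> k" and r0: "scalar_risk t 0 \<le> ennreal r0"
    and r1: "\<And>m. scalar_risk t m \<le> ennreal r1" and nonneg: "r0 \<ge> 0" "r1 \<ge> 0"
  shows "risk n \<sigma> (hard_threshold n (\<sigma> * t)) \<theta> \<le> ennreal (\<sigma>\<^sup>2 * (real n * r0 + real k * r1))"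
proof -
  have "risk n \<sigma> (hard_threshold n (\<sigma> * t)) \<theta> = (\<Sum>i\<in>{1..n}. ennreal (\<sigma>\<^sup>2) * scalar_risk t (\<theta> i / \<sigma>))"
    by (rule risk_hard_threshold[OF \<sigma>])
  also have "\<dots> \<le> (\<Sum>i\<in>{1..n}. ennreal (\<sigma>\<^sup>2 * (r0 + (if \<theta> i \<noteq> 0 then r1 else 0))))"
  proof (rule sum_mono)
    fix i
    have "scalar_risk t (\<theta> i / \<sigma>) \<le> ennreal (r0 + (if \<theta> i \<noteq> 0 then r1 else 0))"
    proof (cases "\<theta> i = 0")
      case False
      have "ennreal r1 \<le> ennreal (r0 + r1)" using nonneg by (intro ennreal_leI) auto
      with r1[of "\<theta> i / \<sigma>"] False show ?thesis by (simp del: ennreal_plus)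
    qed (use r0 in simp)
    from mult_left_mono[OF this, of "ennreal (\<sigma>\<^sup>2)"]
    show "ennreal (\<sigma>\<^sup>2) * scalar_risk t (\<theta> i / \<sigma>) \<le> ennreal (\<sigma>\<^sup>2 * (r0 + (if \<theta> i \<noteq> 0 then r1 else 0)))"
      using nonneg by (subst ennreal_mult) auto
  qed
  also have "\<dots> = ennreal (\<Sum>i\<in>{1..n}. \<sigma>\<^sup>2 * (r0 + (if \<theta> i \<noteq> 0 then r1 else 0)))"
    by (rule sum_ennreal) (use nonneg in auto)
  also have "(\<Sum>i\<in>{1..n}. \<sigma>\<^sup>2 * (r0 + (if \<theta> i \<noteq> 0 then r1 else 0))) = \<sigma>\<^sup>2 * (real n * r0 + real (norm0 n \<theta>) * r1)"
    by (simp add: sum_distrib_left[symmetric] sum.distrib norm0_def sum.If_cases Int_def)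
  also have "ennreal \<dots> \<le> ennreal (\<sigma>\<^sup>2 * (real n * r0 + real k * r1))"
    using \<theta> nonneg by (intro ennreal_leI mult_left_mono add_left_mono mult_right_mono) auto
  finally show ?thesis .
qed

text \<open>The equation between \<open>n\<close>, \<open>t\<close> and \<open>k\<close> says that
  \<open>t\<close> is the \<open>\<nu>\<close> of the problem; it turns the total null risk into
  \<open>2 * t\<close> per spike. The slack is \<open>5 * t\<close> from the worst mean,
  \<open>2 * t\<close> from the nulls and 1 from the noise of a kept coordinate. All other
  parameters are quantified inside the filter, so that \<open>t\<close> may later follow the
  sequence.\<close>

lemma sup_risk_hard_threshold_le:
  "\<forall>\<^sub>F t in at_top. \<forall>n k \<tau> \<sigma>. 0 < \<sigma> \<longrightarrow> real n * exp (- t\<^sup>2 / 2) = real k \<longrightarrow>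
     sup_risk n \<sigma> (param_space n k \<tau>) (hard_threshold n (\<sigma> * t)) \<le>
     ennreal (real k * \<sigma>\<^sup>2 * (t\<^sup>2 - 2 * t * sqrt (2 * ln t) + 8 * t))"
  using worst_mean_bound eventually_ge_at_top[of 2]
proof (eventually_elim, safe)
  fix t \<tau> \<sigma> :: real and n k :: nat
  assume worst: "\<forall>m. m\<^sup>2 * measure std_normal_distribution {..t - \<bar>m\<bar>} \<le> t\<^sup>2 - 2 * t * sqrt (2 * ln t) + 5 * t"
    and t: "2 \<le> t" and \<sigma>: "0 < \<sigma>" and k: "real n * exp (- t\<^sup>2 / 2) = real k"
  define D where "D = t\<^sup>2 - 2 * t * sqrt (2 * ln t) + 5 * t"
  have D: "D \<ge> 0" using worst[rule_format, of 0] by (simp add: D_def)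
  show "sup_risk n \<sigma> (param_space n k \<tau>) (hard_threshold n (\<sigma> * t)) \<le>
     ennreal (real k * \<sigma>\<^sup>2 * (t\<^sup>2 - 2 * t * sqrt (2 * ln t) + 8 * t))"
    unfolding sup_risk_def
  proof (rule SUP_least)
    fix \<theta> assume "\<theta> \<in> param_space n k \<tau>"
    then have "norm0 n \<theta> \<le> k" by (simp add: param_space_def)
    moreover have "scalar_risk t m \<le> ennreal (1 + D)" for m
      by (rule order_trans[OF scalar_risk_le]) (use worst in \<open>auto simp: D_def simp del: ennreal_plus intro!: ennreal_leI\<close>)
    ultimately have "risk n \<sigma> (hard_threshold n (\<sigma> * t)) \<theta> \<le>
        ennreal (\<sigma>\<^sup>2 * (real n * (2 * t * exp (- t\<^sup>2 / 2)) + real k * (1 + D)))"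
      using t D by (intro risk_hard_threshold_le \<sigma> scalar_risk_0_le) auto
    also have "real n * (2 * t * exp (- t\<^sup>2 / 2)) = real k * (2 * t)"
      unfolding k[symmetric] by simp
    also have "ennreal (\<sigma>\<^sup>2 * (real k * (2 * t) + real k * (1 + D))) \<le> ennreal (real k * \<sigma>\<^sup>2 * (D + 3 * t))"
    proof (rule ennreal_leI)
      have "\<sigma>\<^sup>2 * (real k * (2 * t) + real k * (1 + D)) = real k * \<sigma>\<^sup>2 * (D + 2 * t + 1)"
        by (simp add: algebra_simps)
      also have "\<dots> \<le> real k * \<sigma>\<^sup>2 * (D + 3 * t)" using t by (intro mult_left_mono) auto
      finally show "\<sigma>\<^sup>2 * (real k * (2 * t) + real k * (1 + D)) \<le> real k * \<sigma>\<^sup>2 * (D + 3 * t)" .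
    qed
    also have "D + 3 * t = t\<^sup>2 - 2 * t * sqrt (2 * ln t) + 8 * t" by (simp add: D_def)
    finally show "risk n \<sigma> (hard_threshold n (\<sigma> * t)) \<theta> \<le>
       ennreal (real k * \<sigma>\<^sup>2 * (t\<^sup>2 - 2 * t * sqrt (2 * ln t) + 8 * t))" .
  qed
qed

section \<open>Bayes risk of a hidden spike\<close>

text \<open>Completing the square: for every value \<open>e i\<close> of the estimate, the left-hand side is minimal
  at the posterior mean \<open>c * L i / T\<close>.\<close>

lemma spike_posterior_bound:
  fixes e L :: "'a \<Rightarrow> real"
  assumes "finite B" and L: "\<And>j. j \<in> B \<Longrightarrow> L j > 0" and T: "T = (\<Sum>j\<in>B. L j)"
  shows "(\<Sum>i\<in>B. c\<^sup>2 * (1 - L i / T) * L i) \<le> (\<Sum>j\<in>B. (\<Sum>i\<in>B. (e i - (if i = j then c else 0))\<^sup>2) * L j)"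
proof -
  have "(\<Sum>i\<in>B. c\<^sup>2 * (1 - L i / T) * L i) \<le> (\<Sum>i\<in>B. \<Sum>j\<in>B. (e i - (if i = j then c else 0))\<^sup>2 * L j)"
  proof (rule sum_mono)
    fix i assume i: "i \<in> B"
    have T0: "T > 0" unfolding T using assms i by (intro sum_pos) auto
    have rest: "T - L i = (\<Sum>j\<in>B - {i}. L j)"
      unfolding T using \<open>finite B\<close> i by (simp add: sum_diff1)
    have "(\<Sum>j\<in>B. (e i - (if i = j then c else 0))\<^sup>2 * L j) =
        (e i - c)\<^sup>2 * L i + (\<Sum>j\<in>B - {i}. (e i)\<^sup>2 * L j)"
      using \<open>finite B\<close> i by (subst sum.remove[of B i]) (auto intro!: sum.cong split: if_splits)
    also have "\<dots> = (e i - c)\<^sup>2 * L i + (e i)\<^sup>2 * (T - L i)"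
      by (simp add: rest sum_distrib_left)
    also have "\<dots> = c\<^sup>2 * (1 - L i / T) * L i + (e i * T - c * L i)\<^sup>2 / T"
      using T0 by (simp add: field_simps power2_eq_square)
    also have "\<dots> \<ge> c\<^sup>2 * (1 - L i / T) * L i" using T0 by simp
    finally show "c\<^sup>2 * (1 - L i / T) * L i \<le> (\<Sum>j\<in>B. (e i - (if i = j then c else 0))\<^sup>2 * L j)" .
  qed
  also have "\<dots> = (\<Sum>j\<in>B. (\<Sum>i\<in>B. (e i - (if i = j then c else 0))\<^sup>2) * L j)"
    by (subst sum.swap) (simp add: sum_distrib_right)
  finally show ?thesis .
qed

text \<open>The estimator still sees all the data; the loss alone is restricted to \<open>B\<close>.
  Risks over disjoint blocks can therefore be added.\<close>

definition block_risk ::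
  "nat \<Rightarrow> real \<Rightarrow> ((nat \<Rightarrow> real) \<Rightarrow> (nat \<Rightarrow> real)) \<Rightarrow> nat set \<Rightarrow> (nat \<Rightarrow> real) \<Rightarrow> ennreal" where
  "block_risk n \<sigma> est B \<theta> =
     (\<integral>\<^sup>+ y. ennreal (\<Sum>i\<in>B. (est y i - \<theta> i)\<^sup>2) \<partial>gaussian_sequence_model n \<sigma> \<theta>)"

text \<open>The prior on the position of the spike is uniform, so the factors \<open>exp (- \<mu>\<^sup>2 / 2)\<close> of the
  likelihood ratios cancel.\<close>

definition posterior :: "nat set \<Rightarrow> real \<Rightarrow> nat \<Rightarrow> (nat \<Rightarrow> real) \<Rightarrow> real" where
  "posterior B \<mu> i z = exp (\<mu> * z i) / (\<Sum>j\<in>B. exp (\<mu> * z j))"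

lemma posterior_bounds:
  assumes "finite B" "i \<in> B"
  shows "0 \<le> posterior B \<mu> i z" "posterior B \<mu> i z \<le> 1"
proof -
  have "exp (\<mu> * z i) \<le> (\<Sum>j\<in>B. exp (\<mu> * z j))" using assms by (intro member_le_sum) auto
  then show "posterior B \<mu> i z \<le> 1" unfolding posterior_def by (intro divide_le_eq_1[THEN iffD2]) (smt (verit) exp_gt_zero)
  show "0 \<le> posterior B \<mu> i z" by (auto simp: posterior_def intro!: divide_nonneg_nonneg sum_nonneg)
qed

lemma posterior_measurable:
  assumes "B \<subseteq> I" "i \<in> B"
  shows "posterior B \<mu> i \<in> borel_measurable (Pi\<^sub>M I (\<lambda>_. borel))"
proof -
  have [measurable]: "(\<lambda>z. z j) \<in> borel_measurable (Pi\<^sub>M I (\<lambda>_. borel))" if "j \<in> B" for j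
    using that assms by (intro measurable_component_singleton) auto
  show ?thesis using assms(2) unfolding posterior_def[abs_def] by measurable
qed

text \<open>All spike positions are moved to one common measure without a spike in \<open>B\<close>,
  where position \<open>j\<close> has weight \<open>L j\<close>. There the pointwise posterior bound
  applies under the integral. Moving back turns each term into the posterior mass missed when the
  spike is really at \<open>i\<close>.\<close>

lemma block_risk_sum_ge:
  assumes est: "est \<in> vec_space n \<rightarrow>\<^sub>M vec_space n" and B: "B \<subseteq> {1..n}" and \<sigma>: "\<sigma> > 0"
    and \<theta>: "\<And>i. i \<in> B \<Longrightarrow> \<theta> i = 0"
  shows "(\<Sum>i\<in>B. ennreal ((\<sigma> * \<mu>)\<^sup>2) *
      (\<integral>\<^sup>+ z. ennreal (1 - posterior B \<mu> i (z(i := z i + \<mu>))) \<partial>Pi\<^sub>M {1..n} (\<lambda>_. std_normal_distribution)))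
    \<le> (\<Sum>j\<in>B. block_risk n \<sigma> est B (\<theta>(j := \<sigma> * \<mu>)))"
proof -
  let ?P = "Pi\<^sub>M {1..n} (\<lambda>_. std_normal_distribution)"
  define Y :: "(nat \<Rightarrow> real) \<Rightarrow> nat \<Rightarrow> real" where "Y = (\<lambda>z. \<lambda>i\<in>{1..n}. \<theta> i + \<sigma> * z i)"
  define L :: "nat \<Rightarrow> (nat \<Rightarrow> real) \<Rightarrow> real" where "L = (\<lambda>j z. exp (\<mu> * z j - \<mu>\<^sup>2 / 2))"
  define q :: "nat \<Rightarrow> (nat \<Rightarrow> real) \<Rightarrow> real" where "q = (\<lambda>i z. (\<sigma> * \<mu>)\<^sup>2 * (1 - posterior B \<mu> i z))"
  define G where "G = (\<lambda>j z. \<Sum>i\<in>B. (est (Y z) i - (if i = j then \<sigma> * \<mu> else 0))\<^sup>2)"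
  have fB: "finite B" using B finite_subset by auto
  have Y [measurable]: "Y \<in> Pi\<^sub>M {1..n} (\<lambda>_. borel) \<rightarrow>\<^sub>M vec_space n"
    unfolding Y_def by measurable
  have esti [measurable]: "(\<lambda>y. est y i) \<in> borel_measurable (vec_space n)" if "i \<in> B" for i
    using that B by (intro measurable_compose[OF est] measurable_component_singleton) auto
  have G [measurable]: "G j \<in> borel_measurable (Pi\<^sub>M {1..n} (\<lambda>_. borel))" for j
    unfolding G_def by measurable
  have L [measurable]: "L j \<in> borel_measurable (Pi\<^sub>M {1..n} (\<lambda>_. borel))" if "j \<in> B" for j
  proof -
    have [measurable]: "(\<lambda>z. z j) \<in> borel_measurable (Pi\<^sub>M {1..n} (\<lambda>_. borel))"
      using that B by (intro measurable_component_singleton) auto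
    show ?thesis unfolding L_def by measurable
  qed
  have q [measurable]: "q i \<in> borel_measurable (Pi\<^sub>M {1..n} (\<lambda>_. borel))" if "i \<in> B" for i
    using posterior_measurable[OF B that] unfolding q_def by measurable
  have q0: "q i z \<ge> 0" if "i \<in> B" for i z
    using posterior_bounds[OF fB that] by (simp add: q_def)
  have L0: "L j z > 0" for j z by (simp add: L_def)
  have risk: "block_risk n \<sigma> est B (\<theta>(j := \<sigma> * \<mu>)) = (\<integral>\<^sup>+ z. ennreal (G j z * L j z) \<partial>?P)" if j: "j \<in> B" for j
  proof -
    have jn: "j \<in> {1..n}" using j B by auto
    have meas: "(\<lambda>y. ennreal (\<Sum>i\<in>B. (est y i - (\<theta>(j := \<sigma> * \<mu>)) i)\<^sup>2)) \<in> borel_measurable (vec_space n)"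
      by measurable
    have "block_risk n \<sigma> est B (\<theta>(j := \<sigma> * \<mu>)) =
        (\<integral>\<^sup>+ z. ennreal (\<Sum>i\<in>B. (est (\<lambda>i\<in>{1..n}. (\<theta>(j := \<sigma> * \<mu>)) i + \<sigma> * z i) i - (\<theta>(j := \<sigma> * \<mu>)) i)\<^sup>2) \<partial>?P)"
      unfolding block_risk_def gaussian_sequence_model_def
      by (rule nn_integral_distr[OF gaussian_sequence_model_measurable]) (use meas in simp)
    also have "\<dots> = (\<integral>\<^sup>+ z. ennreal (G j (z(j := z j + \<mu>))) \<partial>?P)"
    proof (rule nn_integral_cong)
      fix z :: "nat \<Rightarrow> real"
      \<comment> \<open>A spike of height \<open>\<sigma> * \<mu>\<close> in the mean is the same as
        adding \<open>\<mu>\<close> to the noise at that coordinate.\<close>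
      have "(\<lambda>i\<in>{1..n}. (\<theta>(j := \<sigma> * \<mu>)) i + \<sigma> * z i) = Y (z(j := z j + \<mu>))"
        using \<theta>[OF j] by (auto simp: Y_def algebra_simps)
      moreover have "(\<theta>(j := \<sigma> * \<mu>)) i = (if i = j then \<sigma> * \<mu> else 0)" if "i \<in> B" for i
        using \<theta>[OF that] by auto
      ultimately show "ennreal (\<Sum>i\<in>B. (est (\<lambda>i\<in>{1..n}. (\<theta>(j := \<sigma> * \<mu>)) i + \<sigma> * z i) i - (\<theta>(j := \<sigma> * \<mu>)) i)\<^sup>2) =
          ennreal (G j (z(j := z j + \<mu>)))"
        by (simp add: G_def cong: sum.cong)
    qed
    also have "\<dots> = (\<integral>\<^sup>+ z. ennreal (G j z) * ennreal (L j z) \<partial>?P)"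
      unfolding L_def by (rule nn_integral_PiM_std_normal_shift[OF _ jn]) (simp, measurable)
    also have "\<dots> = (\<integral>\<^sup>+ z. ennreal (G j z * L j z) \<partial>?P)"
      by (intro nn_integral_cong ennreal_mult[symmetric]) (auto simp: G_def L_def intro!: sum_nonneg)
    finally show ?thesis .
  qed
  have "(\<Sum>i\<in>B. ennreal ((\<sigma> * \<mu>)\<^sup>2) * (\<integral>\<^sup>+ z. ennreal (1 - posterior B \<mu> i (z(i := z i + \<mu>))) \<partial>?P)) =
     (\<Sum>i\<in>B. (\<integral>\<^sup>+ z. ennreal (q i z * L i z) \<partial>?P))"
  proof (rule sum.cong[OF refl])
    fix i assume i: "i \<in> B"
    then have "i \<in> {1..n}" using B by auto
    have [measurable]: "(\<lambda>z. ennreal (1 - posterior B \<mu> i z)) \<in> borel_measurable (Pi\<^sub>M {1..n} (\<lambda>_. borel))"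
      using posterior_measurable[OF B i] by measurable
    note [measurable] = L[OF i]
    have "(\<integral>\<^sup>+ z. ennreal (1 - posterior B \<mu> i (z(i := z i + \<mu>))) \<partial>?P) =
        (\<integral>\<^sup>+ z. ennreal (1 - posterior B \<mu> i z) * ennreal (L i z) \<partial>?P)"
      unfolding L_def by (rule nn_integral_PiM_std_normal_shift[OF _ \<open>i \<in> {1..n}\<close>]) (simp, measurable)
    also have "ennreal ((\<sigma> * \<mu>)\<^sup>2) * \<dots> =
        (\<integral>\<^sup>+ z. ennreal ((\<sigma> * \<mu>)\<^sup>2) * (ennreal (1 - posterior B \<mu> i z) * ennreal (L i z)) \<partial>?P)"
      by (rule nn_integral_cmult[symmetric]) measurable
    also have "\<dots> = (\<integral>\<^sup>+ z. ennreal (q i z * L i z) \<partial>?P)"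
      using posterior_bounds[OF fB i] L0
      by (intro nn_integral_cong) (simp add: q_def ennreal_mult less_imp_le mult.assoc)
    finally show "ennreal ((\<sigma> * \<mu>)\<^sup>2) * (\<integral>\<^sup>+ z. ennreal (1 - posterior B \<mu> i (z(i := z i + \<mu>))) \<partial>?P) =
        (\<integral>\<^sup>+ z. ennreal (q i z * L i z) \<partial>?P)" .
  qed
  also have "\<dots> = (\<integral>\<^sup>+ z. (\<Sum>i\<in>B. ennreal (q i z * L i z)) \<partial>?P)"
    by (rule nn_integral_sum[symmetric]) measurable
  also have "\<dots> \<le> (\<integral>\<^sup>+ z. (\<Sum>j\<in>B. ennreal (G j z * L j z)) \<partial>?P)"
  proof (rule nn_integral_mono)
    fix z :: "nat \<Rightarrow> real"
    have "q i z = (\<sigma> * \<mu>)\<^sup>2 * (1 - L i z / (\<Sum>j\<in>B. L j z))" for i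
      by (simp add: q_def L_def posterior_def exp_diff sum_divide_distrib[symmetric])
    then have "(\<Sum>i\<in>B. q i z * L i z) \<le> (\<Sum>j\<in>B. G j z * L j z)"
      using spike_posterior_bound[where e = "est (Y z)" and c = "\<sigma> * \<mu>" and L = "\<lambda>j. L j z", OF fB L0 refl] L0
      by (simp add: G_def)
    then show "(\<Sum>i\<in>B. ennreal (q i z * L i z)) \<le> (\<Sum>j\<in>B. ennreal (G j z * L j z))"
      using q0 L0 by (subst (1 2) sum_ennreal) (auto simp: G_def less_imp_le intro!: ennreal_leI mult_nonneg_nonneg sum_nonneg)
  qed
  also have "\<dots> = (\<Sum>j\<in>B. (\<integral>\<^sup>+ z. ennreal (G j z * L j z) \<partial>?P))"
    by (rule nn_integral_sum) measurable
  also have "\<dots> = (\<Sum>j\<in>B. block_risk n \<sigma> est B (\<theta>(j := \<sigma> * \<mu>)))"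
    by (intro sum.cong) (auto simp: risk)
  finally show ?thesis .
qed

section \<open>Why the posterior misses the spike\<close>

lemma truncated_exp_moments:
  fixes a \<nu> :: real
  defines "\<mu> \<equiv> \<nu> - a" defines "X \<equiv> \<lambda>x. exp (\<mu> * x) * indicator {..\<nu>} x"
  assumes a: "a \<ge> 0" "2 * a \<le> \<nu>" "exp (- a\<^sup>2 / 2) \<le> 1 / 2"
  shows "exp (\<mu>\<^sup>2 / 2) / 2 \<le> std_normal.expectation X"
    and "std_normal.expectation (\<lambda>x. (X x)\<^sup>2) \<le> exp (2 * \<mu>\<^sup>2 - (2 * \<mu> - \<nu>)\<^sup>2 / 2)"
proof -
  \<comment> \<open>Tilting by \<open>m\<close> moves the mean to \<open>m\<close>, so truncation at
    \<open>\<nu>\<close> leaves the mass below \<open>\<nu> - m\<close>. For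
    \<open>m = \<mu>\<close> this is the mass below \<open>a\<close>, at least one half. For
    \<open>m = 2 * \<mu>\<close> the mean has passed the cut, because
    \<open>2 * a \<le> \<nu>\<close>, and only a tail remains.\<close>
  have "(\<integral>\<^sup>+ x. ennreal (exp (m * x) * indicator {..\<nu>} x) \<partial>std_normal_distribution) =
      ennreal (exp (m\<^sup>2 / 2) * measure std_normal_distribution {..\<nu> - m})" for m
  proof -
    have "(\<integral>\<^sup>+ x. ennreal (exp (m * x) * indicator {..\<nu>} x) \<partial>std_normal_distribution) =
      (\<integral>\<^sup>+ x. ennreal (exp (m\<^sup>2 / 2)) * (indicator {..\<nu>} x * ennreal (exp (m * x - m\<^sup>2 / 2))) \<partial>std_normal_distribution)"
      by (intro nn_integral_cong) (auto simp: indicator_def ennreal_mult[symmetric] exp_add[symmetric])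
    also have "\<dots> = ennreal (exp (m\<^sup>2 / 2)) * (\<integral>\<^sup>+ x. indicator {..\<nu>} (x + m) \<partial>std_normal_distribution)"
      by (subst nn_integral_std_normal_shift) (auto intro!: nn_integral_cmult)
    also have "(\<lambda>x. indicator {..\<nu>} (x + m)) = (indicator {..\<nu> - m} :: real \<Rightarrow> ennreal)"
      by (auto simp: indicator_def)
    finally show ?thesis by (simp add: std_normal.emeasure_eq_measure ennreal_mult)
  qed
  then have E: "std_normal.expectation (\<lambda>x. exp (m * x) * indicator {..\<nu>} x) =
      exp (m\<^sup>2 / 2) * measure std_normal_distribution {..\<nu> - m}" for m
    by (subst integral_eq_nn_integral) auto
  have "1 / 2 \<le> measure std_normal_distribution {..a}"
    using std_normal_atMost_ge[OF a(1)] a(3) by linarith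
  then show "exp (\<mu>\<^sup>2 / 2) / 2 \<le> std_normal.expectation X"
    unfolding X_def E by (simp add: \<mu>_def)
  have X2: "(\<lambda>x. (X x)\<^sup>2) = (\<lambda>x. exp (2 * \<mu> * x) * indicator {..\<nu>} x)"
    by (auto simp: X_def indicator_def exp_double[symmetric] mult.assoc)
  have "measure std_normal_distribution {..\<nu> - 2 * \<mu>} \<le> exp (- (2 * \<mu> - \<nu>)\<^sup>2 / 2)"
    using std_normal_atMost_uminus[of "2 * \<mu> - \<nu>"] std_normal_atLeast_le[of "2 * \<mu> - \<nu>"] a(2)
    by (simp add: \<mu>_def)
  then have "std_normal.expectation (\<lambda>x. (X x)\<^sup>2) \<le> exp ((2 * \<mu>)\<^sup>2 / 2) * exp (- (2 * \<mu> - \<nu>)\<^sup>2 / 2)"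
    unfolding X2 E by (intro mult_left_mono) auto
  then show "std_normal.expectation (\<lambda>x. (X x)\<^sup>2) \<le> exp (2 * \<mu>\<^sup>2 - (2 * \<mu> - \<nu>)\<^sup>2 / 2)"
    by (simp add: exp_add[symmetric] power2_eq_square)
qed


text \<open>The spike stays hidden unless its own noise exceeds \<open>a\<close>. Truncating the exponentials at \<open>\<nu>\<close>
  makes their second moment small enough for the sum over the other coordinates to concentrate.\<close>

lemma posterior_miss_ge:
  fixes a \<nu> :: real
  defines "\<mu> \<equiv> \<nu> - a"
  assumes a: "a \<ge> 0" "2 * a \<le> \<nu>" "exp (- a\<^sup>2 / 2) \<le> 1 / 2"
    and I: "finite I" "B \<subseteq> I" "i \<in> B" and card: "exp (\<nu>\<^sup>2 / 2) / 4 \<le> real (card B) - 1"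
  shows "ennreal (1 - (17 * exp (- a\<^sup>2 / 2) + exp (- exp (a\<^sup>2) / 128))) \<le>
    (\<integral>\<^sup>+ z. ennreal (1 - posterior B \<mu> i (z(i := z i + \<mu>))) \<partial>Pi\<^sub>M I (\<lambda>_. std_normal_distribution))"
proof -
  let ?P = "Pi\<^sub>M I (\<lambda>_. std_normal_distribution)"
  interpret P: prob_space ?P by (rule prob_space_PiM_std_normal)
  have fB: "finite B" and iI: "i \<in> I" using I finite_subset by auto
  define J where "J = B - {i}"
  have "card B = Suc (card J)" unfolding J_def using fB I by (intro card.remove)
  then have J: "J \<subseteq> I" "finite J" "real (card J) = real (card B) - 1"
    using I fB by (auto simp: J_def)
  define X where "X = (\<lambda>x. exp (\<mu> * x) * indicator {..\<nu>} x)"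
  define m1 where "m1 = exp (\<mu>\<^sup>2 / 2) / 2"
  define m2 where "m2 = exp (2 * \<mu>\<^sup>2 - (2 * \<mu> - \<nu>)\<^sup>2 / 2)"
  have X [measurable]: "X \<in> borel_measurable borel" by (auto simp: X_def)
  have \<mu>0: "\<mu> \<ge> 0" using a by (simp add: \<mu>_def)
  have XX: "0 \<le> X x" "X x \<le> exp (\<mu> * \<nu>)" "X x \<le> exp (\<mu> * x)" for x
    using \<mu>0 by (auto simp: X_def indicator_def mult_left_mono)
  define bad1 where "bad1 = {z \<in> space ?P. z i \<ge> a}"
  define bad2 where "bad2 = {z \<in> space ?P. (\<Sum>j\<in>J. X (z j)) < real (card J) * m1 / 2}"
  have comp [measurable]: "(\<lambda>z. z j) \<in> borel_measurable ?P" if "j \<in> I" for j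
    using measurable_component_singleton[OF that, of "\<lambda>_. std_normal_distribution"] by simp
  have Xc [measurable]: "(\<lambda>z. X (z j)) \<in> borel_measurable ?P" if "j \<in> J" for j
    using that J by (intro measurable_compose[OF comp X]) auto
  note [measurable] = comp[OF iI]
  have [measurable]: "bad1 \<in> sets ?P" unfolding bad1_def by measurable
  have [measurable]: "bad2 \<in> sets ?P" unfolding bad2_def by measurable
  have b1: "measure ?P bad1 \<le> exp (- a\<^sup>2 / 2)"
  proof -
    have "emeasure ?P bad1 = (\<integral>\<^sup>+ z. indicator bad1 z \<partial>?P)" by simp
    also have "\<dots> = (\<integral>\<^sup>+ z. indicator {a..} (z i) \<partial>?P)"
      by (intro nn_integral_cong) (auto simp: bad1_def indicator_def)
    also have "\<dots> = emeasure std_normal_distribution {a..}"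
      by (subst nn_integral_PiM_std_normal_component[OF iI]) auto
    finally show ?thesis using std_normal_atLeast_le[OF a(1)] by (simp add: measure_def)
  qed
  have b2: "measure ?P bad2 \<le> exp (- exp (a\<^sup>2) / 128)"
  proof -
    have "measure ?P bad2 \<le> exp (- (real (card J) * m1\<^sup>2 / (8 * m2)))"
      unfolding bad2_def
    proof (rule std_normal.prod_lower_tail)
      show "m1 \<le> std_normal.expectation X" "std_normal.expectation (\<lambda>x. (X x)\<^sup>2) \<le> m2"
        using truncated_exp_moments[OF a] unfolding m1_def m2_def X_def \<mu>_def by auto
    qed (use J XX I in \<open>auto simp: m1_def m2_def\<close>)
    also have "\<dots> \<le> exp (- exp (a\<^sup>2) / 128)"
    proof -
      \<comment> \<open>The constant 128 collects 1/4 from the number of coordinates, 1/4 from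
        \<open>m1\<^sup>2\<close> and 1/8 from the tail bound.\<close>
      have "exp (a\<^sup>2) / 128 = exp (\<nu>\<^sup>2 / 2) / 4 * (m1\<^sup>2 / (8 * m2))"
      proof -
        have "a\<^sup>2 = \<nu>\<^sup>2 / 2 + \<mu>\<^sup>2 - (2 * \<mu>\<^sup>2 - (2 * \<mu> - \<nu>)\<^sup>2 / 2)"
          by (simp add: \<mu>_def power2_eq_square field_simps)
        then have ea: "exp (a\<^sup>2) = exp (\<nu>\<^sup>2 / 2) * exp (\<mu>\<^sup>2) / m2"
          by (simp only: m2_def exp_add exp_diff)
        have m1sq: "m1\<^sup>2 = exp (\<mu>\<^sup>2) / 4"
          by (simp add: m1_def power_divide exp_double[symmetric])
        show ?thesis unfolding ea m1sq by simp
      qed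
      also have "\<dots> \<le> real (card J) * (m1\<^sup>2 / (8 * m2))"
        using card by (intro mult_right_mono) (auto simp: J m2_def)
      finally show ?thesis by simp
    qed
    finally show ?thesis .
  qed
  \<comment> \<open>Off both bad events the posterior is at most
    \<open>16 * exp (- a\<^sup>2 / 2)\<close>; on them the indicators suffice. Integration adds the
    probability of \<open>bad1\<close>, hence the 17 of the statement.\<close>
  have pw: "1 \<le> (1 - posterior B \<mu> i (z(i := z i + \<mu>))) + 16 * exp (- a\<^sup>2 / 2) + indicator bad1 z + indicator bad2 z"
    if z: "z \<in> space ?P" for z
  proof (cases "z \<in> bad1 \<or> z \<in> bad2")
    case True
    have "indicator bad1 z + indicator bad2 z \<ge> (1::real)" using True by (auto simp: indicator_def)
    moreover have "16 * exp (- a\<^sup>2 / 2) \<ge> 0" by simp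
    ultimately show ?thesis using posterior_bounds[OF fB I(3), of \<mu> "z(i := z i + \<mu>)"] by linarith
  next
    case False
    define S where "S = (\<Sum>j\<in>J. exp (\<mu> * z j))"
    define E where "E = exp (\<mu> * (z i + \<mu>))"
    have "exp (\<nu>\<^sup>2 / 2) / 4 * m1 / 2 \<le> real (card J) * m1 / 2"
      using card by (intro divide_right_mono mult_right_mono) (auto simp: J m1_def)
    also have "\<dots> \<le> (\<Sum>j\<in>J. X (z j))" using False z by (auto simp: bad2_def)
    also have "\<dots> \<le> S" unfolding S_def by (intro sum_mono XX)
    finally have S: "exp (\<nu>\<^sup>2 / 2 + \<mu>\<^sup>2 / 2) / 16 \<le> S" by (simp add: m1_def exp_add)
    then have S0: "S > 0" by (smt (verit) exp_gt_zero divide_pos_pos)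
    define p where "p = posterior B \<mu> i (z(i := z i + \<mu>))"
    have "p = E / (E + S)"
      unfolding p_def posterior_def using fB I(3)
      by (subst sum.remove[of B i]) (auto simp: E_def S_def J_def intro!: sum.cong arg_cong2[where f = "(/)"])
    also have "\<dots> \<le> E / S" using S0 by (intro divide_left_mono) (auto simp: E_def intro!: mult_pos_pos add_pos_pos)
    also have "\<dots> \<le> exp (\<mu> * (a + \<mu>)) / (exp (\<nu>\<^sup>2 / 2 + \<mu>\<^sup>2 / 2) / 16)"
    proof (rule frac_le)
      show "E \<le> exp (\<mu> * (a + \<mu>))"
        using False z \<mu>0 by (auto simp: E_def bad1_def intro!: mult_left_mono)
    qed (use S in auto)
    also have "\<dots> = 16 * exp (\<mu> * (a + \<mu>) - (\<nu>\<^sup>2 / 2 + \<mu>\<^sup>2 / 2))"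
      by (simp add: exp_diff)
    \<comment> \<open>Since \<open>\<nu> = \<mu> + a\<close>, all terms in \<open>\<mu>\<close>
      cancel: with own noise below \<open>a\<close>, the spike's weight is smaller than the sum over
      the rest by the factor \<open>exp (- a\<^sup>2 / 2)\<close>, up to a constant.\<close>
    also have "\<mu> * (a + \<mu>) - (\<nu>\<^sup>2 / 2 + \<mu>\<^sup>2 / 2) = - a\<^sup>2 / 2"
      by (simp add: \<mu>_def power2_eq_square field_simps)
    finally show ?thesis unfolding p_def[symmetric] using False by (simp add: indicator_def)
  qed
  define Q where "Q = (\<integral>\<^sup>+ z. ennreal (1 - posterior B \<mu> i (z(i := z i + \<mu>))) \<partial>?P)"
  have [measurable]: "(\<lambda>z. posterior B \<mu> i (z(i := z i + \<mu>))) \<in> borel_measurable ?P"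
  proof -
    have "(\<lambda>z. z(i := z i + \<mu>)) \<in> Pi\<^sub>M I (\<lambda>_. borel) \<rightarrow>\<^sub>M Pi\<^sub>M I (\<lambda>_. borel)"
      by (rule measurable_fun_upd[where J = I]) (use iI in auto)
    from measurable_compose[OF this posterior_measurable[OF I(2,3)]] show ?thesis by simp
  qed
  have "ennreal 1 = (\<integral>\<^sup>+ z. ennreal 1 \<partial>?P)" by (simp add: P.emeasure_space_1)
  also have "\<dots> \<le> (\<integral>\<^sup>+ z. ennreal (1 - posterior B \<mu> i (z(i := z i + \<mu>))) + ennreal (16 * exp (- a\<^sup>2 / 2)) +
      indicator bad1 z + indicator bad2 z \<partial>?P)"
  proof (rule nn_integral_mono)
    fix z assume z: "z \<in> space ?P"
    define p where "p = 1 - posterior B \<mu> i (z(i := z i + \<mu>))"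
    have p: "p \<ge> 0" using posterior_bounds[OF fB I(3)] by (simp add: p_def)
    have "ennreal 1 \<le> ennreal (p + 16 * exp (- a\<^sup>2 / 2) + indicator bad1 z + indicator bad2 z)"
      using pw[OF z, folded p_def] by (rule ennreal_leI)
    also have "\<dots> = ennreal p + ennreal (16 * exp (- a\<^sup>2 / 2)) + indicator bad1 z + indicator bad2 z"
      using p by (simp add: ennreal_indicator)
    finally show "ennreal 1 \<le> ennreal (1 - posterior B \<mu> i (z(i := z i + \<mu>))) + ennreal (16 * exp (- a\<^sup>2 / 2)) +
      indicator bad1 z + indicator bad2 z"
      unfolding p_def .
  qed
  also have "\<dots> = Q + ennreal (16 * exp (- a\<^sup>2 / 2)) + emeasure ?P bad1 + emeasure ?P bad2"
    unfolding Q_def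
    by (subst nn_integral_add, measurable, subst nn_integral_add, measurable, subst nn_integral_add, measurable)
       (simp add: P.emeasure_space_1)
  also have "\<dots> \<le> Q + ennreal (16 * exp (- a\<^sup>2 / 2)) + ennreal (exp (- a\<^sup>2 / 2)) + ennreal (exp (- exp (a\<^sup>2) / 128))"
    using b1 b2 by (intro add_mono) (auto simp: P.emeasure_eq_measure intro!: ennreal_leI)
  also have "\<dots> = Q + ennreal (17 * exp (- a\<^sup>2 / 2) + exp (- exp (a\<^sup>2) / 128))"
    by (simp add: add.assoc flip: ennreal_plus)
  finally have "ennreal 1 \<le> ennreal (17 * exp (- a\<^sup>2 / 2) + exp (- exp (a\<^sup>2) / 128)) + Q"
    by (simp only: add.commute)
  then have "ennreal 1 - ennreal (17 * exp (- a\<^sup>2 / 2) + exp (- exp (a\<^sup>2) / 128)) \<le> Q"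
    by (subst ennreal_minus_le_iff) (auto simp only: ennreal_neq_top disj_not1)
  then show ?thesis unfolding Q_def by (subst (asm) ennreal_minus) auto
qed

section \<open>Lower bound for the minimax risk\<close>

text \<open>Redrawing one value of a uniformly random function leaves it uniform: every function
  arises once for each old value at \<open>b\<close>. This lets one block be analysed with the
  spikes of all other blocks held fixed.\<close>

lemma sum_PiE_fun_upd:
  fixes G :: "('a \<Rightarrow> 'b) \<Rightarrow> ennreal"
  assumes K: "finite K" "b \<in> K" and A: "finite A"
  shows "(\<Sum>f\<in>K \<rightarrow>\<^sub>E A. \<Sum>j\<in>A. G (f(b := j))) = of_nat (card A) * (\<Sum>f\<in>K \<rightarrow>\<^sub>E A. G f)"
proof -
  define K' where "K' = K - {b}"
  have K': "K = insert b K'" "b \<notin> K'" using K by (auto simp: K'_def)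
  have reindex: "(\<Sum>f\<in>K \<rightarrow>\<^sub>E A. H f) = (\<Sum>y\<in>A. \<Sum>g\<in>K' \<rightarrow>\<^sub>E A. H (g(b := y)))" for H :: "('a \<Rightarrow> 'b) \<Rightarrow> ennreal"
    unfolding K'(1) PiE_insert_eq
    by (subst sum.reindex[OF inj_combinator[OF K'(2)]]) (simp add: sum.cartesian_product case_prod_unfold)
  have "(\<Sum>f\<in>K \<rightarrow>\<^sub>E A. \<Sum>j\<in>A. G (f(b := j))) = of_nat (card A) * (\<Sum>g\<in>K' \<rightarrow>\<^sub>E A. \<Sum>j\<in>A. G (g(b := j)))"
    by (simp add: reindex)
  also have "(\<Sum>g\<in>K' \<rightarrow>\<^sub>E A. \<Sum>j\<in>A. G (g(b := j))) = (\<Sum>f\<in>K \<rightarrow>\<^sub>E A. G f)"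
    unfolding reindex by (rule sum.swap)
  finally show ?thesis .
qed

text \<open>The least favourable prior: \<open>k\<close> disjoint blocks of length \<open>m\<close>, each with one spike \<open>c\<close> at a
  uniformly random position \<open>f b\<close> inside block \<open>b\<close>.\<close>

definition block :: "nat \<Rightarrow> nat \<Rightarrow> nat set" where
  "block m b = (\<lambda>j. b * m + j + 1) ` {..<m}"

text \<open>Blocks and positions inside them count from 0 while coordinates start at 1, hence the
  \<open>+ 1\<close>. The restriction to \<open>{1..n}\<close> makes the vector extensional, as
  \<open>param_space\<close> demands.\<close>

definition spikes :: "nat \<Rightarrow> nat \<Rightarrow> nat \<Rightarrow> real \<Rightarrow> (nat \<Rightarrow> nat) \<Rightarrow> nat \<Rightarrow> real" where
  "spikes n k m c f = (\<lambda>i\<in>{1..n}. if i \<in> (\<lambda>b. b * m + f b + 1) ` {..<k} then c else 0)"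

lemma block_index_inj:
  fixes j j' m :: nat
  assumes "b * m + j = b' * m + j'" "j < m" "j' < m"
  shows "b = b' \<and> j = j'"
proof -
  have "(b * m + j) div m = b" "(b' * m + j') div m = b'" using assms(2,3) by auto
  then have "b = b'" using assms(1) by (metis add_right_cancel)
  then show ?thesis using assms(1) by simp
qed

lemma block_subset:
  assumes "b < k" "k * m \<le> n"
  shows "block m b \<subseteq> {1..n}"
proof -
  have "b * m + j + 1 \<le> n" if "j < m" for j
  proof -
    have "Suc b * m \<le> k * m" using assms by (intro mult_le_mono1) auto
    with that assms show ?thesis by simp
  qed
  then show ?thesis by (auto simp: block_def)
qed

lemma card_block: "card (block m b) = m"
  unfolding block_def by (subst card_image) (auto simp: inj_on_def)

lemma finite_block: "finite (block m b)"
  by (simp add: block_def)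

lemma block_disjoint:
  assumes "b \<noteq> b'"
  shows "block m b \<inter> block m b' = {}"
  using assms by (auto simp: block_def dest: block_index_inj)

lemma spikes_in_param_space:
  assumes f: "f \<in> {..<k} \<rightarrow>\<^sub>E {..<m}" and n: "k * m \<le> n" and c: "c\<^sup>2 \<le> \<tau>\<^sup>2"
  shows "spikes n k m c f \<in> param_space n k \<tau>"
proof -
  let ?S = "(\<lambda>b. b * m + f b + 1) ` {..<k}"
  have cS: "card ?S \<le> k" using card_image_le[of "{..<k}" "\<lambda>b. b * m + f b + 1"] by simp
  have "norm0 n (spikes n k m c f) \<le> card ?S"
    unfolding norm0_def spikes_def by (intro card_mono) (auto split: if_splits)
  moreover have "sq_norm n (spikes n k m c f) \<le> real k * \<tau>\<^sup>2"
  proof -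
    have "sq_norm n (spikes n k m c f) = (\<Sum>i\<in>{1..n} \<inter> ?S. c\<^sup>2)"
      unfolding sq_norm_def spikes_def by (subst sum.inter_restrict) (auto intro!: sum.cong)
    also have "\<dots> = real (card ({1..n} \<inter> ?S)) * c\<^sup>2" by simp
    also have "\<dots> \<le> real k * \<tau>\<^sup>2"
      using c cS card_mono[of ?S "{1..n} \<inter> ?S"] by (intro mult_mono) auto
    finally show ?thesis .
  qed
  moreover have "spikes n k m c f \<in> {1..n} \<rightarrow>\<^sub>E UNIV" unfolding spikes_def by simp
  ultimately show ?thesis using cS unfolding param_space_def by simp
qed

text \<open>Moving the spike of block \<open>b\<close> yields a baseline that vanishes on the block,
  with one coordinate overwritten: the form to which \<open>block_risk_sum_ge\<close>
  applies.\<close>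

lemma spikes_fun_upd:
  assumes f: "f \<in> {..<k} \<rightarrow>\<^sub>E {..<m}" and b: "b < k" and j: "j < m" and n: "k * m \<le> n"
  shows "spikes n k m c (f(b := j)) =
    (\<lambda>i. if i \<in> block m b then 0 else spikes n k m c f i)(b * m + j + 1 := c)"
proof
  fix i
  have mem: "b * m + j + 1 \<in> block m b" using j by (auto simp: block_def)
  then have mem': "b * m + j + 1 \<in> {1..n}" using block_subset[OF b n] by blast
  have fm: "f b' < m" if "b' < k" for b' using f that by auto
  have *: "i \<in> (\<lambda>b'. b' * m + (f(b := j)) b' + 1) ` {..<k} \<longleftrightarrow>
      i = b * m + j + 1 \<or> (i \<notin> block m b \<and> i \<in> (\<lambda>b'. b' * m + f b' + 1) ` {..<k})"
  proof -
    have other: "b' * m + f b' + 1 \<notin> block m b" if "b' < k" "b' \<noteq> b" for b'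
    proof -
      have "b' * m + f b' + 1 \<in> block m b'" using fm[OF that(1)] by (auto simp: block_def)
      with block_disjoint[OF that(2), of m] show ?thesis by blast
    qed
    have own: "b * m + f b + 1 \<in> block m b" using fm[OF b] by (auto simp: block_def)
    have "i \<notin> block m b \<and> i \<in> (\<lambda>b'. b' * m + f b' + 1) ` {..<k} \<longleftrightarrow>
        (\<exists>b'<k. b' \<noteq> b \<and> i = b' * m + f b' + 1)"
    proof safe
      fix b' assume "b' * m + f b' + 1 \<notin> block m b" "b' < k"
      then show "\<exists>b''<k. b'' \<noteq> b \<and> b' * m + f b' + 1 = b'' * m + f b'' + 1"
        using own by (intro exI[of _ b']) auto
    next
      fix b' assume "b' < k" "b' \<noteq> b" "b' * m + f b' + 1 \<in> block m b"
      then show False using other by blast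
    qed blast
    moreover have "i \<in> (\<lambda>b'. b' * m + (f(b := j)) b' + 1) ` {..<k} \<longleftrightarrow>
        i = b * m + j + 1 \<or> (\<exists>b'<k. b' \<noteq> b \<and> i = b' * m + f b' + 1)"
    proof safe
      fix b' assume "b' < k" "\<not> (\<exists>b''<k. b'' \<noteq> b \<and> b' * m + (f(b := j)) b' + 1 = b'' * m + f b'' + 1)"
      then have "b' = b" by (metis fun_upd_other)
      then show "b' * m + (f(b := j)) b' + 1 = b * m + j + 1" by simp
    next
      show "b * m + j + 1 \<in> (\<lambda>b'. b' * m + (f(b := j)) b' + 1) ` {..<k}"
        using b by (intro image_eqI[of _ _ b]) auto
    next
      fix b' assume "b' < k" "b' \<noteq> b"
      then show "b' * m + f b' + 1 \<in> (\<lambda>b'. b' * m + (f(b := j)) b' + 1) ` {..<k}"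
        by (intro image_eqI[of _ _ b']) auto
    qed
    ultimately show ?thesis by blast
  qed
  show "spikes n k m c (f(b := j)) i =
    ((\<lambda>i. if i \<in> block m b then 0 else spikes n k m c f i)(b * m + j + 1 := c)) i"
  proof (cases "i \<in> {1..n}")
    case True
    then show ?thesis unfolding spikes_def restrict_apply * by (simp only: fun_upd_apply if_True if_False simp_thms split: if_split) blast
  next
    case False
    then have "i \<noteq> b * m + j + 1" "i \<notin> block m b" using mem' block_subset[OF b n] by blast+
    with False show ?thesis by (simp only: spikes_def restrict_apply fun_upd_apply if_False)
  qed
qed

lemma sum_block_risk_le_risk:
  assumes est: "est \<in> vec_space n \<rightarrow>\<^sub>M vec_space n" and n: "k * m \<le> n"
  shows "(\<Sum>b<k. block_risk n \<sigma> est (block m b) \<theta>) \<le> risk n \<sigma> est \<theta>"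
proof -
  have meas: "(\<lambda>y. ennreal (\<Sum>i\<in>block m b. (est y i - \<theta> i)\<^sup>2)) \<in> borel_measurable (gaussian_sequence_model n \<sigma> \<theta>)"
    if b: "b < k" for b
  proof -
    have [measurable]: "(\<lambda>y. est y i) \<in> borel_measurable (vec_space n)" if i: "i \<in> block m b" for i
      using subsetD[OF block_subset[OF b n] i] by (intro measurable_compose[OF est] measurable_component_singleton) auto
    show ?thesis unfolding gaussian_sequence_model_def by measurable
  qed
  have "(\<Sum>b<k. block_risk n \<sigma> est (block m b) \<theta>) =
      (\<integral>\<^sup>+ y. (\<Sum>b<k. ennreal (\<Sum>i\<in>block m b. (est y i - \<theta> i)\<^sup>2)) \<partial>gaussian_sequence_model n \<sigma> \<theta>)"
    unfolding block_risk_def by (rule nn_integral_sum[symmetric]) (auto intro!: meas)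
  also have "\<dots> \<le> risk n \<sigma> est \<theta>"
    unfolding risk_def
  proof (rule nn_integral_mono)
    fix y
    have "(\<Sum>b<k. \<Sum>i\<in>block m b. (est y i - \<theta> i)\<^sup>2) = (\<Sum>i\<in>(\<Union>b<k. block m b). (est y i - \<theta> i)\<^sup>2)"
      by (rule sum.UNION_disjoint[symmetric]) (simp_all add: block_disjoint finite_block)
    also have "\<dots> \<le> sq_norm n (\<lambda>i. est y i - \<theta> i)"
      unfolding sq_norm_def using block_subset[OF _ n] by (intro sum_mono2) auto
    finally show "(\<Sum>b<k. ennreal (\<Sum>i\<in>block m b. (est y i - \<theta> i)\<^sup>2)) \<le> ennreal (sq_norm n (\<lambda>i. est y i - \<theta> i))"
      by (subst sum_ennreal) (auto intro!: sum_nonneg ennreal_leI)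
  qed
  finally show ?thesis .
qed

text \<open>The supremum is at least the average over all placements \<open>f\<close>. Redrawing the
  position in one block at a time bounds each block risk from below on average, and the block risks
  add up to at most the full risk.\<close>

lemma sup_risk_ge_of_posterior:
  assumes est: "est \<in> vec_space n \<rightarrow>\<^sub>M vec_space n" and n: "k * m \<le> n" and m: "m > 0"
    and \<sigma>: "\<sigma> > 0" and c: "(\<sigma> * \<mu>)\<^sup>2 \<le> \<tau>\<^sup>2" and q0: "q \<ge> 0"
    and q: "\<And>b i. b < k \<Longrightarrow> i \<in> block m b \<Longrightarrow> ennreal q \<le>
       (\<integral>\<^sup>+ z. ennreal (1 - posterior (block m b) \<mu> i (z(i := z i + \<mu>))) \<partial>Pi\<^sub>M {1..n} (\<lambda>_. std_normal_distribution))"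
  shows "ennreal (real k * \<sigma>\<^sup>2 * \<mu>\<^sup>2 * q) \<le> sup_risk n \<sigma> (param_space n k \<tau>) est"
proof -
  define F where "F = {..<k} \<rightarrow>\<^sub>E {..<m}"
  define c where "c = \<sigma> * \<mu>"
  define U where "U = sup_risk n \<sigma> (param_space n k \<tau>) est"
  define V where "V = of_nat m * (ennreal (c\<^sup>2) * ennreal q)"
  have F: "finite F" "F \<noteq> {}" using m by (auto simp: F_def finite_PiE PiE_eq_empty_iff)
  have one: "V \<le> (\<Sum>j<m. block_risk n \<sigma> est (block m b) (spikes n k m c (f(b := j))))"
    if f: "f \<in> F" and b: "b < k" for f b
  proof -
    define \<theta> where "\<theta> = (\<lambda>i. if i \<in> block m b then 0 else spikes n k m c f i)"
    have "V = (\<Sum>i\<in>block m b. ennreal (c\<^sup>2) * ennreal q)" by (simp add: V_def card_block)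
    also have "\<dots> \<le> (\<Sum>i\<in>block m b. ennreal (c\<^sup>2) *
      (\<integral>\<^sup>+ z. ennreal (1 - posterior (block m b) \<mu> i (z(i := z i + \<mu>))) \<partial>Pi\<^sub>M {1..n} (\<lambda>_. std_normal_distribution)))"
      by (intro sum_mono mult_left_mono q b) auto
    also have "\<dots> \<le> (\<Sum>i\<in>block m b. block_risk n \<sigma> est (block m b) (\<theta>(i := c)))"
      unfolding c_def by (rule block_risk_sum_ge[OF est block_subset[OF b n] \<sigma>]) (auto simp: \<theta>_def)
    also have "\<dots> = (\<Sum>j<m. block_risk n \<sigma> est (block m b) (\<theta>(b * m + j + 1 := c)))"
      by (subst (1) block_def, subst sum.reindex) (auto simp: inj_on_def)
    also have "\<dots> = (\<Sum>j<m. block_risk n \<sigma> est (block m b) (spikes n k m c (f(b := j))))"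
      using f b n by (intro sum.cong) (auto simp: spikes_fun_upd F_def \<theta>_def)
    finally show ?thesis .
  qed
  have "of_nat (card F) * of_nat k * V = (\<Sum>b<k. \<Sum>f\<in>F. V)" by (simp add: mult_ac)
  also have "\<dots> \<le> (\<Sum>b<k. \<Sum>f\<in>F. \<Sum>j<m. block_risk n \<sigma> est (block m b) (spikes n k m c (f(b := j))))"
    by (intro sum_mono one) auto
  also have "\<dots> = (\<Sum>b<k. of_nat m * (\<Sum>f\<in>F. block_risk n \<sigma> est (block m b) (spikes n k m c f)))"
  proof (rule sum.cong[OF refl])
    fix b assume "b \<in> {..<k}"
    then show "(\<Sum>f\<in>F. \<Sum>j<m. block_risk n \<sigma> est (block m b) (spikes n k m c (f(b := j)))) =
       of_nat m * (\<Sum>f\<in>F. block_risk n \<sigma> est (block m b) (spikes n k m c f))"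
      using sum_PiE_fun_upd[of "{..<k}" b "{..<m}" "\<lambda>f. block_risk n \<sigma> est (block m b) (spikes n k m c f)"]
      by (simp add: F_def)
  qed
  also have "\<dots> = of_nat m * (\<Sum>f\<in>F. \<Sum>b<k. block_risk n \<sigma> est (block m b) (spikes n k m c f))"
    by (subst sum.swap) (simp add: sum_distrib_left)
  also have "\<dots> \<le> of_nat m * (\<Sum>f\<in>F. U)"
  proof (intro mult_left_mono sum_mono)
    fix f assume "f \<in> F"
    then have "spikes n k m c f \<in> param_space n k \<tau>"
      using assms by (intro spikes_in_param_space) (auto simp: F_def c_def)
    then have "risk n \<sigma> est (spikes n k m c f) \<le> U" unfolding U_def sup_risk_def by (rule SUP_upper)
    then show "(\<Sum>b<k. block_risk n \<sigma> est (block m b) (spikes n k m c f)) \<le> U"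
      using sum_block_risk_le_risk[OF est n] order_trans by blast
  qed auto
  finally have "of_nat (card F) * of_nat k * V \<le> of_nat m * (of_nat (card F) * U)" by simp
  then have "of_nat (card F * m) * (of_nat k * (ennreal (c\<^sup>2) * ennreal q)) \<le> of_nat (card F * m) * U"
    by (simp add: V_def mult_ac)
  \<comment> \<open>The number of pairs is positive and finite, so it may be cancelled even though
    \<open>U\<close> could be infinite.\<close>
  then have "of_nat k * (ennreal (c\<^sup>2) * ennreal q) \<le> U"
    using F m by (subst (asm) ennreal_mult_le_mult_iff) (auto simp: ennreal_of_nat_eq_real_of_nat ennreal_mult_eq_top_iff)
  also have "of_nat k * (ennreal (c\<^sup>2) * ennreal q) = ennreal (real k * \<sigma>\<^sup>2 * \<mu>\<^sup>2 * q)"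
    using q0 by (simp add: c_def ennreal_of_nat_eq_real_of_nat ennreal_mult[symmetric] power_mult_distrib mult_ac)
  finally show ?thesis unfolding U_def .
qed

text \<open>The relative loss \<open>17 / t\<close> of a square close to \<open>t\<^sup>2\<close>
  costs about \<open>17 * t\<close>; one further \<open>t\<close> absorbs the exponential
  term.\<close>

lemma spike_risk_asymptotics:
  "\<forall>\<^sub>F t::real in at_top. t\<^sup>2 - 2 * t * sqrt (2 * ln t) - 18 * t \<le>
     (t - sqrt (2 * ln t))\<^sup>2 * (1 - (17 / t + exp (- t\<^sup>2 / 128)))"
  by real_asymp

lemma minimax_risk_ge:
  "\<forall>\<^sub>F t in at_top. \<forall>n k \<tau> \<sigma>. 0 < \<sigma> \<longrightarrow> 0 < k \<longrightarrow> real n * exp (- t\<^sup>2 / 2) = real k \<longrightarrow> \<sigma> * t \<le> \<tau> \<longrightarrow>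
     ennreal (real k * \<sigma>\<^sup>2 * (t\<^sup>2 - 2 * t * sqrt (2 * ln t) - 18 * t)) \<le> minimax_risk n (param_space n k \<tau>) \<sigma>"
proof -
  have "\<forall>\<^sub>F t::real in at_top. 17 / t + exp (- t\<^sup>2 / 128) \<le> 1" by real_asymp
  moreover have "\<forall>\<^sub>F t::real in at_top. 2 * sqrt (2 * ln t) \<le> t" by real_asymp
  \<comment> \<open>The 2 pays for rounding \<open>n / k\<close> down to the block length and for
    leaving out the spike's own coordinate.\<close>
  moreover have "\<forall>\<^sub>F t::real in at_top. exp (t\<^sup>2 / 2) / 4 \<le> exp (t\<^sup>2 / 2) - 2" by real_asymp
  ultimately show ?thesis
    using spike_risk_asymptotics eventually_ge_at_top[of 2]
  proof (eventually_elim, safe)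
    fix t \<tau> \<sigma> :: real and n k :: nat
    assume q0: "17 / t + exp (- t\<^sup>2 / 128) \<le> 1" and at: "2 * sqrt (2 * ln t) \<le> t"
      and M: "exp (t\<^sup>2 / 2) / 4 \<le> exp (t\<^sup>2 / 2) - 2"
      and asymp: "t\<^sup>2 - 2 * t * sqrt (2 * ln t) - 18 * t \<le>
         (t - sqrt (2 * ln t))\<^sup>2 * (1 - (17 / t + exp (- t\<^sup>2 / 128)))"
      and t: "2 \<le> t" and \<sigma>: "0 < \<sigma>" and k: "0 < k" and nk: "real n * exp (- t\<^sup>2 / 2) = real k"
      and \<tau>: "\<sigma> * t \<le> \<tau>"
    define a where "a = sqrt (2 * ln t)"
    define q where "q = 1 - (17 / t + exp (- t\<^sup>2 / 128))"
    define m where "m = n div k"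
    have a: "a \<ge> 0" "a\<^sup>2 = 2 * ln t" using t by (auto simp: a_def)
    have ea: "exp (- a\<^sup>2 / 2) = 1 / t" "exp (a\<^sup>2) = t\<^sup>2"
      unfolding a(2) exp_double using t by (simp_all add: exp_minus field_simps)
    have "real n / real k = exp (t\<^sup>2 / 2)"
      using k nk[symmetric] t by (auto simp: exp_minus field_simps)
    moreover have "\<lfloor>real n / real k\<rfloor> = int m"
      unfolding m_def by (rule floor_divide_of_nat_eq)
    then have "real n / real k \<le> real m + 1" by linarith
    ultimately have m: "exp (t\<^sup>2 / 2) / 4 \<le> real m - 1" using M by linarith
    moreover have "exp (t\<^sup>2 / 2) > 0" by simp
    ultimately have "real m > 0" by linarith
    then have m0: "m > 0" by simp
    have n: "k * m \<le> n" by (simp add: m_def)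
    show "ennreal (real k * \<sigma>\<^sup>2 * (t\<^sup>2 - 2 * t * sqrt (2 * ln t) - 18 * t)) \<le> minimax_risk n (param_space n k \<tau>) \<sigma>"
      unfolding minimax_risk_def
    proof (rule INF_greatest)
      fix est assume est: "est \<in> vec_space n \<rightarrow>\<^sub>M vec_space n"
      have "ennreal (real k * \<sigma>\<^sup>2 * (t\<^sup>2 - 2 * t * sqrt (2 * ln t) - 18 * t)) \<le>
         ennreal (real k * \<sigma>\<^sup>2 * ((t - a)\<^sup>2 * q))"
        using asymp unfolding a_def[symmetric] q_def[symmetric] by (intro ennreal_leI mult_left_mono) auto
      also have "\<dots> = ennreal (real k * \<sigma>\<^sup>2 * (t - a)\<^sup>2 * q)" by (simp add: mult_ac)
      also have "\<dots> \<le> sup_risk n \<sigma> (param_space n k \<tau>) est"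
      proof (rule sup_risk_ge_of_posterior[OF est n m0 \<sigma>])
        \<comment> \<open>Signal strength enters here: the spike height has to fit below
          \<open>\<tau>\<close>.\<close>
        have "\<sigma> * (t - a) \<le> \<sigma> * t" using a \<sigma> by simp
        then have "\<sigma> * (t - a) \<le> \<tau>" using \<tau> by linarith
        then show "(\<sigma> * (t - a))\<^sup>2 \<le> \<tau>\<^sup>2"
          using \<sigma> at a t by (intro power_mono) (auto simp: a_def[symmetric])
        show "q \<ge> 0" using q0 by (simp add: q_def)
        fix b i assume bi: "b < k" "i \<in> block m b"
        have "ennreal (1 - (17 * exp (- a\<^sup>2 / 2) + exp (- exp (a\<^sup>2) / 128))) \<le>
          (\<integral>\<^sup>+ z. ennreal (1 - posterior (block m b) (t - a) i (z(i := z i + (t - a)))) \<partial>Pi\<^sub>M {1..n} (\<lambda>_. std_normal_distribution))"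
        proof (rule posterior_miss_ge[OF a(1)])
          show "2 * a \<le> t" using at by (simp add: a_def)
          show "exp (- a\<^sup>2 / 2) \<le> 1 / 2" unfolding ea(1) using t by simp
          show "block m b \<subseteq> {1..n}" by (rule block_subset[OF bi(1) n])
        qed (use bi m in \<open>auto simp: card_block\<close>)
        then show "ennreal q \<le>
          (\<integral>\<^sup>+ z. ennreal (1 - posterior (block m b) (t - a) i (z(i := z i + (t - a)))) \<partial>Pi\<^sub>M {1..n} (\<lambda>_. std_normal_distribution))"
          unfolding ea q_def by simp
      qed
      finally show "ennreal (real k * \<sigma>\<^sup>2 * (t\<^sup>2 - 2 * t * sqrt (2 * ln t) - 18 * t)) \<le>
        sup_risk n \<sigma> (param_space n k \<tau>) est" .
    qed
  qed
qed

section \<open>The second order expansion\<close>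

text \<open>The remainder \<open>r\<close> is obtained by solving the expansion for it. Bounds
  \<open>C * \<nu>\<close> away from the main terms, divided by
  \<open>2 * \<nu> * sqrt (2 * ln \<nu>)\<close>, leave an error of order
  \<open>1 / sqrt (2 * ln \<nu>)\<close>.\<close>

lemma second_order_remainder:
  fixes N s \<nu> e :: "nat \<Rightarrow> real" and R :: "nat \<Rightarrow> ennreal"
  assumes \<nu>: "filterlim \<nu> at_top sequentially" and C: "C \<ge> 0"
    and pos: "\<forall>\<^sub>F n in sequentially. N n * e n > 0"
    and lower: "\<forall>\<^sub>F n in sequentially. ennreal (N n * e n * ((\<nu> n)\<^sup>2 - 2 * \<nu> n * sqrt (2 * ln (\<nu> n)) - C * \<nu> n)) \<le> R n"
    and upper: "\<forall>\<^sub>F n in sequentially. R n \<le> ennreal (N n * e n * ((\<nu> n)\<^sup>2 - 2 * \<nu> n * sqrt (2 * ln (\<nu> n)) + C * \<nu> n))"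
  shows "\<exists>r. r \<longlonglongrightarrow> 0 \<and> (\<forall>\<^sub>F n in sequentially.
    enn2ereal (R n) = ereal (N n * (e n * (\<nu> n)\<^sup>2 - 2 * e n * \<nu> n * sqrt (2 * ln (\<nu> n)) * (1 + r n))))"
proof -
  define a where "a = (\<lambda>n. sqrt (2 * ln (\<nu> n)))"
  define r where "r = (\<lambda>n. ((\<nu> n)\<^sup>2 - 2 * \<nu> n * a n - enn2real (R n) / (N n * e n)) / (2 * \<nu> n * a n))"
  have "filterlim (\<lambda>t::real. sqrt (2 * ln t)) at_top at_top" by real_asymp
  from filterlim_compose[OF this \<nu>] have a: "filterlim a at_top sequentially" by (simp add: a_def)
  \<comment> \<open>\<open>ennreal\<close> sends negative reals to 0, so the upper bound passes to
    the reals once it is known to be nonnegative; this follows from the nonnegative lower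
    bound.\<close>
  have "\<forall>\<^sub>F t::real in at_top. 0 \<le> t\<^sup>2 - 2 * t * sqrt (2 * ln t) - C * t" by real_asymp
  from eventually_compose_filterlim[OF this \<nu>]
  have nonneg: "\<forall>\<^sub>F n in sequentially. 0 \<le> (\<nu> n)\<^sup>2 - 2 * \<nu> n * a n - C * \<nu> n" by (simp add: a_def)
  have a0: "\<forall>\<^sub>F n in sequentially. a n > 0" and \<nu>0: "\<forall>\<^sub>F n in sequentially. \<nu> n > 0"
    using a \<nu> by (auto simp: filterlim_at_top_dense)
  have bounds: "\<forall>\<^sub>F n in sequentially. R n = ennreal (enn2real (R n)) \<and>
     N n * e n * ((\<nu> n)\<^sup>2 - 2 * \<nu> n * a n - C * \<nu> n) \<le> enn2real (R n) \<and>
     enn2real (R n) \<le> N n * e n * ((\<nu> n)\<^sup>2 - 2 * \<nu> n * a n + C * \<nu> n)"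
    using lower upper pos nonneg \<nu>0
  proof eventually_elim
    case (elim n)
    define l where "l = N n * e n * ((\<nu> n)\<^sup>2 - 2 * \<nu> n * a n - C * \<nu> n)"
    define u where "u = N n * e n * ((\<nu> n)\<^sup>2 - 2 * \<nu> n * a n + C * \<nu> n)"
    have l: "ennreal l \<le> R n" and u: "R n \<le> ennreal u" and l0: "0 \<le> l"
      using elim by (auto simp: l_def u_def a_def)
    obtain x where x: "x \<ge> 0" "R n = ennreal x"
      using u by (cases "R n") (auto simp: top_unique)
    have "l \<le> x" using l x by simp
    moreover have "l \<le> u"
      unfolding l_def u_def using elim C by (intro mult_left_mono) auto
    then have "x \<le> u" using u x l0 by simp
    ultimately show ?case unfolding l_def[symmetric] u_def[symmetric] using x by simp
  qed
  have "\<forall>\<^sub>F n in sequentially. norm (r n) \<le> C / 2 * inverse (a n)"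
    using bounds a0 \<nu>0 pos
  proof eventually_elim
    case (elim n)
    define y where "y = enn2real (R n) / (N n * e n)"
    have "(\<nu> n)\<^sup>2 - 2 * \<nu> n * a n - C * \<nu> n \<le> y" "y \<le> (\<nu> n)\<^sup>2 - 2 * \<nu> n * a n + C * \<nu> n"
      using elim by (auto simp: y_def pos_le_divide_eq pos_divide_le_eq mult_ac)
    then have "\<bar>(\<nu> n)\<^sup>2 - 2 * \<nu> n * a n - y\<bar> \<le> C * \<nu> n" by linarith
    then have "\<bar>(\<nu> n)\<^sup>2 - 2 * \<nu> n * a n - y\<bar> / (2 * \<nu> n * a n) \<le> C * \<nu> n / (2 * \<nu> n * a n)"
      using elim by (intro divide_right_mono) auto
    then have "\<bar>r n\<bar> \<le> C * \<nu> n / (2 * \<nu> n * a n)"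
      using elim by (simp add: r_def y_def[symmetric] abs_divide abs_mult)
    also have "\<dots> = C / 2 * inverse (a n)" using elim by (simp add: field_simps)
    finally show ?case by simp
  qed
  moreover have "(\<lambda>n. C / 2 * inverse (a n)) \<longlonglongrightarrow> 0"
    using tendsto_mult[OF tendsto_const tendsto_inverse_0_at_top[OF a], of "C / 2"] by simp
  ultimately have "r \<longlonglongrightarrow> 0" by (rule Lim_null_comparison)
  moreover have "\<forall>\<^sub>F n in sequentially.
    enn2ereal (R n) = ereal (N n * (e n * (\<nu> n)\<^sup>2 - 2 * e n * \<nu> n * sqrt (2 * ln (\<nu> n)) * (1 + r n)))"
    using bounds a0 \<nu>0 pos
  proof eventually_elim
    case (elim n)
    have "2 * \<nu> n * a n * (1 + r n) = (\<nu> n)\<^sup>2 - enn2real (R n) / (N n * e n)"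
      using elim by (simp add: r_def field_simps)
    then have "N n * e n * ((\<nu> n)\<^sup>2 - 2 * \<nu> n * a n * (1 + r n)) = N n * e n * (enn2real (R n) / (N n * e n))"
      by simp
    also have "\<dots> = enn2real (R n)"
    proof -
      have "N n * e n \<noteq> 0" using elim by linarith
      then show ?thesis by (metis nonzero_mult_div_cancel_left times_divide_eq_right)
    qed
    finally have "N n * e n * ((\<nu> n)\<^sup>2 - 2 * \<nu> n * a n * (1 + r n)) = enn2real (R n)" .
    moreover have "N n * (e n * (\<nu> n)\<^sup>2 - 2 * e n * \<nu> n * sqrt (2 * ln (\<nu> n)) * (1 + r n)) =
       N n * e n * ((\<nu> n)\<^sup>2 - 2 * \<nu> n * a n * (1 + r n))"
      by (simp add: a_def algebra_simps)
    ultimately show ?case using elim by (metis enn2ereal_ennreal enn2real_nonneg)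
  qed
  ultimately show ?thesis by blast
qed

theorem theorem6:
  fixes k :: "nat \<Rightarrow> nat" and \<tau> \<sigma> \<epsilon> \<mu> \<nu> :: "nat \<Rightarrow> real"
  assumes "\<And>n. n \<ge> 1 \<Longrightarrow> 1 \<le> k n \<and> k n \<le> n"
    and "\<And>n. n \<ge> 1 \<Longrightarrow> \<tau> n > 0"
    and "\<And>n. n \<ge> 1 \<Longrightarrow> \<sigma> n > 0"
    and "\<And>n. n \<ge> 1 \<Longrightarrow> \<epsilon> n = real (k n) / real n"
    and "\<And>n. n \<ge> 1 \<Longrightarrow> \<mu> n = \<tau> n / \<sigma> n"
    and "\<And>n. n \<ge> 1 \<Longrightarrow> \<nu> n = sqrt (2 * ln (1 / \<epsilon> n))"
    and "\<epsilon> \<longlonglongrightarrow> 0"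
    and "(\<lambda>n. sqrt (ln (1 / \<epsilon> n)) / \<mu> n) \<longlonglongrightarrow> 0"
  shows "(\<exists>r :: nat \<Rightarrow> real. r \<longlonglongrightarrow> 0 \<and>
      (\<forall>\<^sub>F n in sequentially.
         enn2ereal (minimax_risk n (param_space n (k n) (\<tau> n)) (\<sigma> n)) =
         ereal (real n * (\<sigma> n)\<^sup>2 *
           (2 * \<epsilon> n * ln (1 / \<epsilon> n) - 2 * \<epsilon> n * \<nu> n * sqrt (2 * ln (\<nu> n)) * (1 + r n))))) \<and>
    (\<exists>r :: nat \<Rightarrow> real. r \<longlonglongrightarrow> 0 \<and>
      (\<forall>\<^sub>F n in sequentially.
         enn2ereal (sup_risk n (\<sigma> n) (param_space n (k n) (\<tau> n))
           (hard_threshold n (\<sigma> n * sqrt (2 * ln (1 / \<epsilon> n))))) =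
         ereal (real n * (\<sigma> n)\<^sup>2 *
           (2 * \<epsilon> n * ln (1 / \<epsilon> n) - 2 * \<epsilon> n * \<nu> n * sqrt (2 * ln (\<nu> n)) * (1 + r n)))))"
proof -
  define A where "A = (\<lambda>n. minimax_risk n (param_space n (k n) (\<tau> n)) (\<sigma> n))"
  define S where "S = (\<lambda>n. sup_risk n (\<sigma> n) (param_space n (k n) (\<tau> n)) (hard_threshold n (\<sigma> n * \<nu> n)))"
  have ge1: "\<forall>\<^sub>F n in sequentially. n \<ge> 1" by (rule eventually_ge_at_top)
  have \<epsilon>: "\<epsilon> n > 0" "\<epsilon> n \<le> 1" if "n \<ge> 1" for n
    using assms(1,4)[OF that] that by auto
  have \<nu>2: "(\<nu> n)\<^sup>2 = 2 * ln (1 / \<epsilon> n)" "\<nu> n \<ge> 0" if "n \<ge> 1" for n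
    using \<epsilon>[OF that] by (auto simp: assms(6)[OF that])
  have "\<forall>\<^sub>F n in sequentially. \<epsilon> n \<in> {0<..} \<and> \<epsilon> n \<noteq> 0"
    using ge1 by eventually_elim (use \<epsilon>(1) in force)
  then have "filterlim \<epsilon> (at_right 0) sequentially"
    using assms(7) by (simp add: filterlim_at)
  moreover have "filterlim (\<lambda>x::real. sqrt (2 * ln (1 / x))) at_top (at_right 0)" by real_asymp
  ultimately have lim: "filterlim (\<lambda>n. sqrt (2 * ln (1 / \<epsilon> n))) at_top sequentially"
    by (rule filterlim_compose[rotated])
  have eq: "\<forall>\<^sub>F n in sequentially. sqrt (2 * ln (1 / \<epsilon> n)) = \<nu> n"
    using ge1 by eventually_elim (simp add: assms(6))
  from lim have \<nu>: "filterlim \<nu> at_top sequentially"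
    unfolding filterlim_cong[OF refl refl eq] .
  have signal: "\<forall>\<^sub>F n in sequentially. \<sigma> n * \<nu> n \<le> \<tau> n"
  proof -
    \<comment> \<open>The level \<open>1 / sqrt 2\<close> makes up for the factor in
      \<open>\<nu> = sqrt 2 * sqrt (ln (1 / \<epsilon>))\<close>, so that the conclusion is
      \<open>\<nu> < \<mu>\<close>.\<close>
    have "\<forall>\<^sub>F n in sequentially. sqrt (ln (1 / \<epsilon> n)) / \<mu> n < 1 / sqrt 2"
      using assms(8) by (rule order_tendstoD) simp
    then show ?thesis using ge1
    proof eventually_elim
      case (elim n)
      have "sqrt (ln (1 / \<epsilon> n)) = \<nu> n / sqrt 2"
        by (simp add: assms(6)[OF elim(2)] real_sqrt_mult)
      with elim have "\<nu> n < \<mu> n" using assms(2,3)[OF elim(2)]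
        by (simp add: assms(5)[OF elim(2)] field_simps)
      then show ?case using assms(3)[OF elim(2)] by (simp add: assms(5)[OF elim(2)] field_simps)
    qed
  qed
  have nk: "real n * exp (- (\<nu> n)\<^sup>2 / 2) = real (k n)" if "n \<ge> 1" for n
  proof -
    have "exp (- (\<nu> n)\<^sup>2 / 2) = \<epsilon> n" using \<epsilon>[OF that] \<nu>2[OF that] by (simp add: ln_div)
    then show ?thesis using that assms(4)[OF that] by simp
  qed
  have scale: "real n * (\<sigma> n)\<^sup>2 * \<epsilon> n = real (k n) * (\<sigma> n)\<^sup>2" if "n \<ge> 1" for n
    using that by (simp add: assms(4)[OF that])
  have lower: "\<forall>\<^sub>F n in sequentially. ennreal (real n * (\<sigma> n)\<^sup>2 * \<epsilon> n *
      ((\<nu> n)\<^sup>2 - 2 * \<nu> n * sqrt (2 * ln (\<nu> n)) - 18 * \<nu> n)) \<le> A n"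
    using eventually_compose_filterlim[OF minimax_risk_ge \<nu>] signal ge1
  proof eventually_elim
    case (elim n)
    show ?case
      unfolding scale[OF elim(3)] A_def
      by (rule elim(1)[rule_format]) (use assms(1,3)[OF elim(3)] nk[OF elim(3)] elim(2) in auto)
  qed
  \<comment> \<open>Hard thresholding is one of the competing estimators, so the lower bound for
    \<open>A\<close> and the upper bound for \<open>S\<close> enclose both quantities.\<close>
  have mid: "A n \<le> S n" for n
    unfolding A_def S_def minimax_risk_def by (rule INF_lower[OF hard_threshold_measurable])
  have upper: "\<forall>\<^sub>F n in sequentially. S n \<le> ennreal (real n * (\<sigma> n)\<^sup>2 * \<epsilon> n *
      ((\<nu> n)\<^sup>2 - 2 * \<nu> n * sqrt (2 * ln (\<nu> n)) + 18 * \<nu> n))"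
    using eventually_compose_filterlim[OF sup_risk_hard_threshold_le \<nu>] ge1
  proof eventually_elim
    case (elim n)
    have "S n \<le> ennreal (real (k n) * (\<sigma> n)\<^sup>2 * ((\<nu> n)\<^sup>2 - 2 * \<nu> n * sqrt (2 * ln (\<nu> n)) + 8 * \<nu> n))"
      unfolding S_def by (rule elim(1)[rule_format]) (use assms(3)[OF elim(2)] nk[OF elim(2)] in auto)
    also have "\<dots> \<le> ennreal (real (k n) * (\<sigma> n)\<^sup>2 * ((\<nu> n)\<^sup>2 - 2 * \<nu> n * sqrt (2 * ln (\<nu> n)) + 18 * \<nu> n))"
      using \<nu>2[OF elim(2)] by (intro ennreal_leI mult_left_mono) auto
    finally show ?case unfolding scale[OF elim(2)] .
  qed
  have pos: "\<forall>\<^sub>F n in sequentially. real n * (\<sigma> n)\<^sup>2 * \<epsilon> n > 0"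
    using ge1
  proof eventually_elim
    case (elim n)
    then show ?case using \<epsilon>[OF elim] assms(3)[OF elim] by auto
  qed
  \<comment> \<open>Any \<open>R\<close> between \<open>A\<close> and \<open>S\<close> has the
    expansion. The copy \<open>R'\<close> allows the threshold to be written out as in the claim,
    where it agrees with \<open>\<nu>\<close> for \<open>n \<ge> 1\<close>.\<close>
  have cast: "\<exists>r. r \<longlonglongrightarrow> 0 \<and> (\<forall>\<^sub>F n in sequentially. enn2ereal (R' n) = ereal (real n * (\<sigma> n)\<^sup>2 *
           (2 * \<epsilon> n * ln (1 / \<epsilon> n) - 2 * \<epsilon> n * \<nu> n * sqrt (2 * ln (\<nu> n)) * (1 + r n))))"
    if R: "\<forall>\<^sub>F n in sequentially. A n \<le> R n" "\<forall>\<^sub>F n in sequentially. R n \<le> S n"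
      and eq: "\<And>n. n \<ge> 1 \<Longrightarrow> R' n = R n" for R R'
  proof -
    have l: "\<forall>\<^sub>F n in sequentially. ennreal (real n * (\<sigma> n)\<^sup>2 * \<epsilon> n *
      ((\<nu> n)\<^sup>2 - 2 * \<nu> n * sqrt (2 * ln (\<nu> n)) - 18 * \<nu> n)) \<le> R n"
      using lower R(1) by eventually_elim (rule order_trans)
    have u: "\<forall>\<^sub>F n in sequentially. R n \<le> ennreal (real n * (\<sigma> n)\<^sup>2 * \<epsilon> n *
      ((\<nu> n)\<^sup>2 - 2 * \<nu> n * sqrt (2 * ln (\<nu> n)) + 18 * \<nu> n))"
      using R(2) upper by eventually_elim (rule order_trans)
    from second_order_remainder[OF \<nu> zero_le_numeral pos l u] obtain r where r: "r \<longlonglongrightarrow> 0" "\<forall>\<^sub>F n in sequentially. enn2ereal (R n) = ereal (real n * (\<sigma> n)\<^sup>2 *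
           (\<epsilon> n * (\<nu> n)\<^sup>2 - 2 * \<epsilon> n * \<nu> n * sqrt (2 * ln (\<nu> n)) * (1 + r n)))"
      by blast
    have "\<forall>\<^sub>F n in sequentially. enn2ereal (R' n) = ereal (real n * (\<sigma> n)\<^sup>2 *
           (2 * \<epsilon> n * ln (1 / \<epsilon> n) - 2 * \<epsilon> n * \<nu> n * sqrt (2 * ln (\<nu> n)) * (1 + r n)))"
      using r(2) ge1
    proof eventually_elim
      case (elim n)
      have "\<epsilon> n * (\<nu> n)\<^sup>2 = 2 * \<epsilon> n * ln (1 / \<epsilon> n)" by (simp add: \<nu>2[OF elim(2)])
      then show ?case using elim(1) unfolding eq[OF elim(2)] by simp
    qed
    with r(1) show ?thesis by blast
  qed
  show ?thesis
  proof
    show "\<exists>r. r \<longlonglongrightarrow> 0 \<and> (\<forall>\<^sub>F n in sequentially.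
         enn2ereal (minimax_risk n (param_space n (k n) (\<tau> n)) (\<sigma> n)) =
         ereal (real n * (\<sigma> n)\<^sup>2 *
           (2 * \<epsilon> n * ln (1 / \<epsilon> n) - 2 * \<epsilon> n * \<nu> n * sqrt (2 * ln (\<nu> n)) * (1 + r n))))"
      by (rule cast[of A]) (auto simp: mid, simp add: A_def)
    show "\<exists>r. r \<longlonglongrightarrow> 0 \<and> (\<forall>\<^sub>F n in sequentially.
         enn2ereal (sup_risk n (\<sigma> n) (param_space n (k n) (\<tau> n))
           (hard_threshold n (\<sigma> n * sqrt (2 * ln (1 / \<epsilon> n))))) =
         ereal (real n * (\<sigma> n)\<^sup>2 *
           (2 * \<epsilon> n * ln (1 / \<epsilon> n) - 2 * \<epsilon> n * \<nu> n * sqrt (2 * ln (\<nu> n)) * (1 + r n))))"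
      by (rule cast[of S]) (auto simp: mid, simp add: S_def assms(6))
  qed
qed

end
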